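(* Let $\varphi$ and $\psi$ be bounded analytic functions on the open unit disc $\mathbb{U}$. If $\varphi$ is univalent and $X$ is a nonzero bounded linear operator on $H^2$ with $XT_\varphi=T_\psi X$, then $X$ is a weighted composition operator.
   Context: $\mathbb{U}$ is the open unit disc in $\mathbb{C}$ and $H^2$ is the Hardy space of $\mathbb{U}$. For a bounded analytic function $\varphi$ on $\mathbb{U}$, $T_\varphi:H^2\to H^2$ is the analytic Toeplitz operator $T_\varphi h=\varphi h$. Univalent means injective on $\mathbb{U}$. A weighted composition operator on $H^2$ is an operator $C_{\omega,h}$ of the form $C_{\omega,h}f=h\cdot(f\circ\omega)$ for $f\in H^2$, where $\omega:\mathbb{U}\to\mathbb{U}$ is holomorphic and $h\in H^2$ is such that $h\cdot(f\circ\omega)\in H^2$ for every $f\in H^2$. *)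

theory Defs
  imports "HOL-Complex_Analysis.Complex_Analysis"
begin

abbreviation unit_disc :: "complex set"
  where "unit_disc \<equiv> ball 0 1"

definition circle_mean :: "(complex \<Rightarrow> complex) \<Rightarrow> real \<Rightarrow> real"
  where "circle_mean f r =
    (1 / (2 * pi)) * integral {0..2 * pi} (\<lambda>t. (cmod (f (complex_of_real r * cis t)))\<^sup>2)"

text \<open>
  A function on the disc is represented by its extension by 0 to the whole plane, so that two
  elements of the Hardy space agree on the disc iff they are equal as HOL functions, and
  pointwise operations make the set a complex vector space.
\<close>

definition hardy2 :: "(complex \<Rightarrow> complex) set"
  where "hardy2 = {f. f holomorphic_on unit_disc \<and> (\<forall>z. z \<notin> unit_disc \<longrightarrow> f z = 0)
    \<and> bdd_above (circle_mean f ` {0..<1})}"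

definition hardy2_norm :: "(complex \<Rightarrow> complex) \<Rightarrow> real"
  where "hardy2_norm f = sqrt (SUP r\<in>{0..<1}. circle_mean f r)"

text \<open>Only the restriction of an operator to \<^const>\<open>hardy2\<close> is meaningful.\<close>

definition bounded_operator_hardy2 ::
    "((complex \<Rightarrow> complex) \<Rightarrow> (complex \<Rightarrow> complex)) \<Rightarrow> bool"
  where "bounded_operator_hardy2 X \<longleftrightarrow>
    (\<forall>f\<in>hardy2. X f \<in> hardy2) \<and>
    (\<forall>f\<in>hardy2. \<forall>g\<in>hardy2. X (\<lambda>z. f z + g z) = (\<lambda>z. X f z + X g z)) \<and>
    (\<forall>c. \<forall>f\<in>hardy2. X (\<lambda>z. c * f z) = (\<lambda>z. c * X f z)) \<and>
    (\<exists>K. \<forall>f\<in>hardy2. hardy2_norm (X f) \<le> K * hardy2_norm f)"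

text \<open>
  For \<open>f\<close> and \<open>h\<close> in \<^const>\<open>hardy2\<close> the two products below vanish off the disc, whatever the
  values of \<open>\<phi>\<close> and \<open>\<omega>\<close> are there.
\<close>

definition toeplitz :: "(complex \<Rightarrow> complex) \<Rightarrow> (complex \<Rightarrow> complex) \<Rightarrow> complex \<Rightarrow> complex"
  where "toeplitz \<phi> f = (\<lambda>z. \<phi> z * f z)"

definition weighted_comp ::
    "(complex \<Rightarrow> complex) \<Rightarrow> (complex \<Rightarrow> complex) \<Rightarrow> (complex \<Rightarrow> complex) \<Rightarrow> complex \<Rightarrow> complex"
  where "weighted_comp \<omega> h f = (\<lambda>z. h z * f (\<omega> z))"

definition is_weighted_composition_operator ::
    "((complex \<Rightarrow> complex) \<Rightarrow> (complex \<Rightarrow> complex)) \<Rightarrow> bool"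
  where "is_weighted_composition_operator X \<longleftrightarrow>
    (\<exists>\<omega> h. \<omega> holomorphic_on unit_disc \<and> \<omega> ` unit_disc \<subseteq> unit_disc \<and> h \<in> hardy2 \<and>
      (\<forall>f\<in>hardy2. weighted_comp \<omega> h f \<in> hardy2) \<and>
      (\<forall>f\<in>hardy2. X f = weighted_comp \<omega> h f))"

end

theory Submission
  imports Defs
begin

text \<open>
  Fix \<open>z\<close> in the disc and let \<open>L f = X f z\<close>, a bounded functional on \<^const>\<open>hardy2\<close>. The
  intertwining relation says that \<open>L\<close> is an eigenvector of the adjoint of multiplication by
  \<open>\<phi>\<close>: \<open>L (\<phi> f) = \<mu> L f\<close> with \<open>\<mu> = \<psi> z\<close>, that is, \<open>L\<close> annihilates \<open>(\<phi> - \<mu>) H\<^sup>2\<close>. For univalent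
  \<open>\<phi>\<close> these eigenvectors can be listed completely.

  \<^item> If \<open>\<mu> = \<phi> w\<close> with \<open>w\<close> in the disc, then \<open>\<phi> - \<mu>\<close> has one simple zero and is bounded below
    away from it, so every \<open>f - f w\<close> is \<open>\<phi> - \<mu>\<close> times an element of \<open>H\<^sup>2\<close>. Hence
    \<open>L f = L 1 * f w\<close>.
  \<^item> If \<open>\<mu>\<close> is not a value of \<open>\<phi>\<close>, then \<open>F = \<phi> - \<mu>\<close> is univalent and zero-free, and such an \<open>F\<close> is
    outer: \<open>F H\<^sup>2\<close> is dense and \<open>L = 0\<close>.

  So \<open>\<psi> z\<close> is a value of \<open>\<phi>\<close> wherever some \<open>X f\<close> does not vanish, and there
  \<open>X f z = X 1 z * f (\<phi>\<^sup>-\<^sup>1 (\<psi> z))\<close>. The exceptional set consists of zeros of a nonzero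
  holomorphic function, hence the bounded function \<open>\<phi>\<^sup>-\<^sup>1 \<circ> \<psi>\<close> extends over it; the maximum modulus
  principle keeps the extension inside the open disc.

  The main work is to show that \<open>F\<close> is outer. It suffices that \<open>F\<close> have a root \<open>Q\<close>, \<open>Q\<^sup>N = F\<close>, with
  \<open>P = 1 / Q\<close> in \<open>H\<^sup>2\<close>: if \<open>L\<close> annihilates \<open>Q\<^sup>k\<^sup>+\<^sup>1 H\<^sup>2\<close>, then it annihilates
  \<open>Q\<^sup>k\<^sup>+\<^sup>1 P p = Q\<^sup>k p\<close> for every polynomial \<open>p\<close>, hence \<open>Q\<^sup>k H\<^sup>2\<close> by density, and one descends
  to \<open>k = 0\<close>. That \<open>P\<close> lies in \<open>H\<^sup>2\<close> rests on two applications of Bloch's theorem. Write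
  \<open>F = exp l\<close>. As \<open>exp l\<close> is injective, the range of \<open>l\<close> contains no two points differing by
  \<open>2 \<pi> \<i>\<close>, so it contains no disc of radius \<open>4\<close>, and Bloch's theorem bounds \<open>l'\<close> by a multiple of
  \<open>1 / (1 - |z|)\<close>; for large \<open>N\<close> the function \<open>P = exp (- l / N)\<close> then grows as slowly as desired.
  Moreover \<open>P\<close> is again univalent, so the images of disjoint discs are disjoint. By
  Bloch's theorem the image of a disc contains one whose radius is proportional to the radius of
  the first and to \<open>|P'|\<close> at its centre. Comparing areas bounds the mean square of \<open>P'\<close> on
  circles, which by Parseval's identity gives square summable Taylor coefficients.
\<close>

section \<open>Parseval's identity on circles\<close>

lemma has_integral_cis_int:
  fixes k :: int
  shows "((\<lambda>t. cis (of_int k * t)) has_integral (if k = 0 then 2 * pi else 0)) {0..2 * pi}"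
proof (cases "k = 0")
  case True
  then show ?thesis
    using has_integral_const_real[of "1::complex" 0 "2*pi"] by (simp add: scaleR_conv_of_real)
next
  case False
  have "((\<lambda>t. cis (of_int k * t)) has_integral
      (cis (of_int k * (2*pi)) / (\<i> * of_int k) - cis (of_int k * 0) / (\<i> * of_int k))) {0..2 * pi}"
  proof (rule fundamental_theorem_of_calculus)
    fix t :: real
    have "((\<lambda>z. exp (\<i> * (of_int k * z)) / (\<i> * of_int k)) has_field_derivative
        exp (\<i> * (of_int k * of_real t))) (at (of_real t))"
      by (rule derivative_eq_intros refl | use False in \<open>simp add: field_simps\<close>)+
    then have "((\<lambda>t. exp (\<i> * (of_int k * of_real t)) / (\<i> * of_int k)) has_vector_derivative
        exp (\<i> * (of_int k * of_real t))) (at t within {0..2*pi})"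
      by (rule has_vector_derivative_real_field)
    then show "((\<lambda>t. cis (of_int k * t) / (\<i> * of_int k)) has_vector_derivative
        cis (of_int k * t)) (at t within {0..2*pi})"
      by (simp add: cis_conv_exp)
  qed auto
  moreover have "cis (of_int k * (2*pi)) = 1"
    using cis_multiple_2pi[of "of_int k"] by (simp add: mult.commute mult.left_commute)
  ultimately show ?thesis using False by simp
qed

lemma has_integral_trig_poly:
  fixes c :: "nat \<Rightarrow> complex"
  shows "((\<lambda>t. (cmod (\<Sum>n<N. c n * cis (real n * t)))\<^sup>2) has_integral
    2 * pi * (\<Sum>n<N. (cmod (c n))\<^sup>2)) {0..2 * pi}"
proof -
  have expand: "complex_of_real ((cmod (\<Sum>n<N. c n * cis (real n * t)))\<^sup>2)
      = (\<Sum>n<N. \<Sum>k<N. c n * cnj (c k) * cis (of_int (int n - int k) * t))" for t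
  proof -
    have "complex_of_real ((cmod (\<Sum>n<N. c n * cis (real n * t)))\<^sup>2)
        = (\<Sum>n<N. c n * cis (real n * t)) * (\<Sum>k<N. cnj (c k) * cis (- (real k * t)))"
      unfolding complex_norm_square by (simp add: cis_cnj)
    also have "\<dots> = (\<Sum>n<N. \<Sum>k<N. c n * cnj (c k) * (cis (real n * t) * cis (- (real k * t))))"
      by (simp add: sum_product mult_ac)
    finally show ?thesis by (simp add: cis_mult algebra_simps)
  qed
  have "((\<lambda>t. \<Sum>n<N. \<Sum>k<N. c n * cnj (c k) * cis (of_int (int n - int k) * t)) has_integral
      (\<Sum>n<N. \<Sum>k<N. c n * cnj (c k) * (if int n - int k = 0 then 2 * pi else 0))) {0..2 * pi}"
    by (intro has_integral_sum has_integral_mult_right has_integral_cis_int) auto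
  then have "((\<lambda>t. complex_of_real ((cmod (\<Sum>n<N. c n * cis (real n * t)))\<^sup>2)) has_integral
      (\<Sum>n<N. \<Sum>k<N. c n * cnj (c k) * (if int n - int k = 0 then 2 * pi else 0))) {0..2 * pi}"
    unfolding expand .
  moreover have "(\<Sum>n<N. \<Sum>k<N. c n * cnj (c k) * (if int n - int k = 0 then 2 * pi else 0))
      = complex_of_real (2 * pi * (\<Sum>n<N. (cmod (c n))\<^sup>2))"
  proof -
    have "(\<Sum>k<N. c n * cnj (c k) * (if int n - int k = 0 then 2 * pi else 0))
        = 2 * pi * complex_of_real ((cmod (c n))\<^sup>2)" if "n < N" for n
    proof -
      have "(\<Sum>k<N. c n * cnj (c k) * (if int n - int k = 0 then 2 * pi else 0))
          = (\<Sum>k<N. if k = n then c n * cnj (c n) * (2 * pi) else 0)"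
        by (intro sum.cong) auto
      then show ?thesis using that by (simp add: complex_norm_square [symmetric] mult_ac)
    qed
    then show ?thesis by (simp add: sum_distrib_left)
  qed
  ultimately have "((\<lambda>t. complex_of_real ((cmod (\<Sum>n<N. c n * cis (real n * t)))\<^sup>2)) has_integral
      complex_of_real (2 * pi * (\<Sum>n<N. (cmod (c n))\<^sup>2))) {0..2 * pi}" by simp
  from has_integral_Re[OF this] show ?thesis by simp
qed

text \<open>
  The coefficient sequence is left free instead of being read off from \<open>f\<close>, so that the identity
  applies directly to remainders of Taylor series and to rotated functions.
\<close>

lemma parseval_circle_mean:
  fixes a :: "nat \<Rightarrow> complex"
  assumes sums: "\<And>z. z \<in> unit_disc \<Longrightarrow> (\<lambda>n. a n * z ^ n) sums f z" and r: "0 \<le> r" "r < 1"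
  shows "(\<lambda>n. (cmod (a n))\<^sup>2 * (r ^ n)\<^sup>2) sums circle_mean f r"
proof -
  define c where "c = (\<lambda>n. a n * of_real r ^ n)"
  define s where "s = (\<lambda>N t. \<Sum>n<N. c n * cis (real n * t))"
  have c_cis: "c n * cis (real n * t) = a n * (of_real r * cis t) ^ n" for n t
    by (simp add: c_def power_mult_distrib Complex.DeMoivre mult.assoc)
  have lim: "(\<lambda>N. s N t) \<longlonglongrightarrow> f (of_real r * cis t)" for t
    using sums[of "of_real r * cis t"] r unfolding sums_def s_def c_cis by (simp add: norm_mult)
  have summ: "summable (\<lambda>n. cmod (c n))"
  proof -
    obtain \<rho> where \<rho>: "r < \<rho>" "\<rho> < 1" using r dense by blast
    have "summable (\<lambda>n. a n * complex_of_real \<rho> ^ n)"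
      using sums[of "of_real \<rho>"] \<rho> r by (auto intro: sums_summable)
    from powser_insidea[OF this, of "of_real r"] show ?thesis
      using \<rho> r by (simp add: c_def)
  qed
  define B where "B = (\<Sum>n. cmod (c n))"
  have s_le: "cmod (s N t) \<le> B" for N t
  proof -
    have "cmod (s N t) \<le> (\<Sum>n<N. cmod (c n))"
      unfolding s_def by (rule order_trans[OF norm_sum]) (simp add: norm_mult)
    also have "\<dots> \<le> B" unfolding B_def by (rule sum_le_suminf[OF summ]) auto
    finally show ?thesis .
  qed
  have s_int: "((\<lambda>t. (cmod (s N t))\<^sup>2) has_integral 2 * pi * (\<Sum>n<N. (cmod (c n))\<^sup>2)) {0..2 * pi}" for N
    unfolding s_def by (rule has_integral_trig_poly)
  have "(\<lambda>N. integral {0..2*pi} (\<lambda>t. (cmod (s N t))\<^sup>2))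
      \<longlonglongrightarrow> integral {0..2*pi} (\<lambda>t. (cmod (f (of_real r * cis t)))\<^sup>2)"
  proof (rule dominated_convergence(2)[where h = "\<lambda>_. B\<^sup>2"])
    show "(\<lambda>t. (cmod (s N t))\<^sup>2) integrable_on {0..2*pi}" for N using s_int by blast
    show "norm ((cmod (s N t))\<^sup>2) \<le> B\<^sup>2" for N t using s_le[of N t] by (simp add: power_mono)
    show "(\<lambda>N. (cmod (s N t))\<^sup>2) \<longlonglongrightarrow> (cmod (f (of_real r * cis t)))\<^sup>2" for t
      by (intro tendsto_intros lim)
  qed auto
  then have "(\<lambda>N. 1 / (2*pi) * (2 * pi * (\<Sum>n<N. (cmod (c n))\<^sup>2))) \<longlonglongrightarrow> circle_mean f r"
    unfolding circle_mean_def by (intro tendsto_mult_left) (simp add: integral_unique[OF s_int])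
  moreover have "(cmod (c n))\<^sup>2 = (cmod (a n))\<^sup>2 * (r ^ n)\<^sup>2" for n
    using r by (simp add: c_def norm_mult norm_power power_mult_distrib)
  ultimately show ?thesis by (simp add: sums_def)
qed

section \<open>Taylor coefficients and norms in the Hardy space\<close>

definition taylor_coeff :: "(complex \<Rightarrow> complex) \<Rightarrow> nat \<Rightarrow> complex"
  where "taylor_coeff f n = (deriv ^^ n) f 0 / fact n"

lemma taylor_sums:
  assumes "f holomorphic_on unit_disc" "z \<in> unit_disc"
  shows "(\<lambda>n. taylor_coeff f n * z ^ n) sums f z"
  using holomorphic_power_series[OF assms] by (simp add: taylor_coeff_def)

lemma taylor_coeff_deriv: "taylor_coeff (deriv f) n = of_nat (Suc n) * taylor_coeff f (Suc n)"
proof -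
  have "(deriv ^^ n) (deriv f) 0 = (deriv ^^ Suc n) f 0"
    by (simp only: funpow_Suc_right o_apply)
  moreover have "1 + complex_of_nat n \<noteq> 0"
    using of_nat_neq_0[of n, where ?'a = complex] by simp
  ultimately show ?thesis
    by (simp add: taylor_coeff_def fact_Suc del: funpow.simps)
qed

lemma circle_mean_integrable:
  assumes "f holomorphic_on unit_disc" "0 \<le> r" "r < 1"
  shows "(\<lambda>t. (cmod (f (complex_of_real r * cis t)))\<^sup>2) integrable_on {0..2 * pi}"
proof (rule integrable_continuous_interval)
  have "continuous_on {0..2*pi} (f \<circ> (\<lambda>t. complex_of_real r * cis t))"
    using assms
    by (intro continuous_on_compose continuous_intros
        continuous_on_subset[OF holomorphic_on_imp_continuous_on[OF assms(1)]])
      (auto simp: norm_mult)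
  then show "continuous_on {0..2*pi} (\<lambda>t. (cmod (f (complex_of_real r * cis t)))\<^sup>2)"
    unfolding o_def by (intro continuous_intros)
qed

lemma circle_mean_nonneg: "circle_mean f r \<ge> 0"
proof -
  have "integral {0..2*pi} (\<lambda>t. (cmod (f (complex_of_real r * cis t)))\<^sup>2) \<ge> 0"
    by (metis integral_nonneg not_integrable_integral order_refl zero_le_power2)
  then show ?thesis by (simp add: circle_mean_def)
qed

lemma circle_mean_dominated:
  assumes f: "f holomorphic_on unit_disc" and g: "g holomorphic_on unit_disc"
    and r: "0 \<le> r" "r < 1"
    and le: "\<And>z. z \<in> unit_disc \<Longrightarrow> (cmod (g z))\<^sup>2 \<le> A + B * (cmod (f z))\<^sup>2"
  shows "circle_mean g r \<le> A + B * circle_mean f r"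
proof -
  have int: "((\<lambda>t. A + B * (cmod (f (complex_of_real r * cis t)))\<^sup>2) has_integral
      A * (2*pi) + B * (2 * pi * circle_mean f r)) {0..2*pi}"
  proof (rule has_integral_add)
    show "((\<lambda>t. A) has_integral A * (2*pi)) {0..2*pi}"
      using has_integral_const_real[of A 0 "2*pi"] by (simp add: mult_ac)
    have "((\<lambda>t. (cmod (f (complex_of_real r * cis t)))\<^sup>2) has_integral 2 * pi * circle_mean f r) {0..2*pi}"
      using integrable_integral[OF circle_mean_integrable[OF f r]] by (simp add: circle_mean_def)
    then show "((\<lambda>t. B * (cmod (f (complex_of_real r * cis t)))\<^sup>2) has_integral
        B * (2 * pi * circle_mean f r)) {0..2*pi}"
      by (rule has_integral_mult_right)
  qed
  have "integral {0..2*pi} (\<lambda>t. (cmod (g (complex_of_real r * cis t)))\<^sup>2)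
      \<le> A * (2*pi) + B * (2 * pi * circle_mean f r)"
    unfolding integral_unique[OF int, symmetric]
    using r by (intro integral_le circle_mean_integrable[OF g] has_integral_integrable[OF int] le)
      (auto simp: norm_mult)
  also have "\<dots> = 2 * pi * (A + B * circle_mean f r)" by (simp add: algebra_simps)
  finally show ?thesis
    by (simp add: circle_mean_def divide_simps mult.commute)
qed

lemma hardy2_holomorphic: "f \<in> hardy2 \<Longrightarrow> f holomorphic_on unit_disc"
  by (simp add: hardy2_def)

lemma hardy2_outside: "f \<in> hardy2 \<Longrightarrow> z \<notin> unit_disc \<Longrightarrow> f z = 0"
  unfolding hardy2_def by blast

lemma circle_mean_le_hardy2_norm:
  assumes "f \<in> hardy2" "0 \<le> r" "r < 1"
  shows "circle_mean f r \<le> (hardy2_norm f)\<^sup>2"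
proof -
  have "circle_mean f r \<le> (SUP r\<in>{0..<1}. circle_mean f r)"
    using assms by (intro cSUP_upper) (auto simp: hardy2_def)
  moreover from this have "(SUP r\<in>{0..<1}. circle_mean f r) \<ge> 0"
    using circle_mean_nonneg[of f r] by linarith
  ultimately show ?thesis by (simp add: hardy2_norm_def)
qed

lemma hardy2I:
  assumes "f holomorphic_on unit_disc" "\<And>z. z \<notin> unit_disc \<Longrightarrow> f z = 0"
    and le: "\<And>r. 0 \<le> r \<Longrightarrow> r < 1 \<Longrightarrow> circle_mean f r \<le> C"
  shows "f \<in> hardy2" and "hardy2_norm f \<le> sqrt C"
proof -
  show "f \<in> hardy2" unfolding hardy2_def using assms by (auto intro!: bdd_aboveI[where M = C])
  show "hardy2_norm f \<le> sqrt C"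
    unfolding hardy2_norm_def by (intro real_sqrt_le_mono cSUP_least) (auto intro: le)
qed

lemma hardy2_norm_nonneg:
  assumes "f \<in> hardy2" shows "hardy2_norm f \<ge> 0"
proof -
  have "circle_mean f 0 \<le> (SUP r\<in>{0..<1}. circle_mean f r)"
    using assms by (intro cSUP_upper) (auto simp: hardy2_def)
  then show ?thesis using circle_mean_nonneg[of f 0] unfolding hardy2_norm_def by simp
qed

text \<open>
  The additive constant is for functions that are controlled by \<open>f\<close> only near the boundary of the
  disc and by a constant elsewhere.
\<close>

lemma hardy2_dominated:
  assumes f: "f \<in> hardy2" and g: "g holomorphic_on unit_disc" "\<And>z. z \<notin> unit_disc \<Longrightarrow> g z = 0"
    and B: "B \<ge> 0"
    and le: "\<And>z. z \<in> unit_disc \<Longrightarrow> (cmod (g z))\<^sup>2 \<le> A + B * (cmod (f z))\<^sup>2"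
  shows "g \<in> hardy2" and "hardy2_norm g \<le> sqrt (A + B * (hardy2_norm f)\<^sup>2)"
proof -
  have *: "circle_mean g r \<le> A + B * (hardy2_norm f)\<^sup>2" if "0 \<le> r" "r < 1" for r
  proof -
    have "circle_mean g r \<le> A + B * circle_mean f r"
      by (rule circle_mean_dominated[OF hardy2_holomorphic[OF f] g(1) that le])
    also have "\<dots> \<le> A + B * (hardy2_norm f)\<^sup>2"
      using circle_mean_le_hardy2_norm[OF f that] B by (simp add: mult_left_mono)
    finally show ?thesis .
  qed
  show "g \<in> hardy2" "hardy2_norm g \<le> sqrt (A + B * (hardy2_norm f)\<^sup>2)"
    using hardy2I[OF g *] by auto
qed

lemma zero_in_hardy2: "(\<lambda>z. 0) \<in> hardy2"
  by (rule hardy2I[where C = 0]) (auto simp: circle_mean_def)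

definition disc_restrict :: "(complex \<Rightarrow> complex) \<Rightarrow> complex \<Rightarrow> complex"
  where "disc_restrict f = (\<lambda>z. if z \<in> unit_disc then f z else 0)"

lemma disc_restrict_holomorphic:
  "f holomorphic_on unit_disc \<Longrightarrow> disc_restrict f holomorphic_on unit_disc"
  by (rule holomorphic_transform) (auto simp: disc_restrict_def)

lemma bounded_in_hardy2:
  assumes "f holomorphic_on unit_disc" "bounded (f ` unit_disc)"
  shows "disc_restrict f \<in> hardy2"
proof -
  obtain B where B: "\<And>z. z \<in> unit_disc \<Longrightarrow> cmod (f z) \<le> B"
    using assms(2) unfolding bounded_iff by blast
  show ?thesis
  proof (rule hardy2_dominated(1)[OF zero_in_hardy2, where A = "B\<^sup>2" and B = 0])
    show "(cmod (disc_restrict f z))\<^sup>2 \<le> B\<^sup>2 + 0 * (cmod 0)\<^sup>2" if "z \<in> unit_disc" for z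
      using B[OF that] that by (simp add: disc_restrict_def power_mono)
    show "disc_restrict f holomorphic_on unit_disc"
      by (rule disc_restrict_holomorphic[OF assms(1)])
  qed (auto simp: disc_restrict_def)
qed

lemma toeplitz_hardy2:
  assumes b: "b holomorphic_on unit_disc" and B: "B \<ge> 0" "\<And>z. z \<in> unit_disc \<Longrightarrow> cmod (b z) \<le> B"
    and f: "f \<in> hardy2"
  shows "toeplitz b f \<in> hardy2" and "hardy2_norm (toeplitz b f) \<le> B * hardy2_norm f"
proof -
  have le: "(cmod (toeplitz b f z))\<^sup>2 \<le> 0 + B\<^sup>2 * (cmod (f z))\<^sup>2" if "z \<in> unit_disc" for z
    using B(2)[OF that] by (simp add: toeplitz_def norm_mult power_mult_distrib mult_right_mono power_mono)
  have holo: "toeplitz b f holomorphic_on unit_disc"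
    unfolding toeplitz_def by (intro holomorphic_intros b hardy2_holomorphic f)
  have out: "toeplitz b f z = 0" if "z \<notin> unit_disc" for z
    using hardy2_outside[OF f that] by (simp add: toeplitz_def)
  show "toeplitz b f \<in> hardy2"
    by (rule hardy2_dominated(1)[OF f holo out _ le]) auto
  have "hardy2_norm (toeplitz b f) \<le> sqrt (0 + B\<^sup>2 * (hardy2_norm f)\<^sup>2)"
    by (rule hardy2_dominated(2)[OF f holo out _ le]) auto
  then show "hardy2_norm (toeplitz b f) \<le> B * hardy2_norm f"
    using B(1) hardy2_norm_nonneg[OF f] by (simp add: real_sqrt_mult)
qed

text \<open>
  Parseval's identity on the circle of radius \<open>r\<close>, in the limit \<open>r \<rightarrow> 1\<close>.
\<close>

lemma hardy2_coeff_sum_le: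
  assumes f: "f \<in> hardy2"
  shows "(\<Sum>n<N. (cmod (taylor_coeff f n))\<^sup>2) \<le> (hardy2_norm f)\<^sup>2"
proof (rule tendsto_le[OF _ tendsto_const])
  show "((\<lambda>r::real. \<Sum>n<N. (cmod (taylor_coeff f n))\<^sup>2 * (r ^ n)\<^sup>2)
      \<longlongrightarrow> (\<Sum>n<N. (cmod (taylor_coeff f n))\<^sup>2)) (at_left 1)"
    by (rule tendsto_eq_rhs, (rule tendsto_intros)+) auto
  have "(\<Sum>n<N. (cmod (taylor_coeff f n))\<^sup>2 * (r ^ n)\<^sup>2) \<le> (hardy2_norm f)\<^sup>2"
    if r: "0 < r" "r < 1" for r :: real
  proof -
    have "(\<lambda>n. (cmod (taylor_coeff f n))\<^sup>2 * (r ^ n)\<^sup>2) sums circle_mean f r"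
      using r by (intro parseval_circle_mean taylor_sums hardy2_holomorphic f) auto
    then have "(\<Sum>n<N. (cmod (taylor_coeff f n))\<^sup>2 * (r ^ n)\<^sup>2) \<le> circle_mean f r"
      unfolding sums_iff using sum_le_suminf[of "\<lambda>n. (cmod (taylor_coeff f n))\<^sup>2 * (r ^ n)\<^sup>2" "{..<N}"]
      by auto
    also have "\<dots> \<le> (hardy2_norm f)\<^sup>2"
      using r by (intro circle_mean_le_hardy2_norm f) auto
    finally show ?thesis .
  qed
  then show "\<forall>\<^sub>F r in at_left 1. (\<Sum>n<N. (cmod (taylor_coeff f n))\<^sup>2 * (r ^ n)\<^sup>2) \<le> (hardy2_norm f)\<^sup>2"
    by (auto simp: eventually_at_left_field intro!: exI[of _ 0])
qed auto

lemma hardy2_coeff_summable: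
  assumes "f \<in> hardy2"
  shows "summable (\<lambda>n. (cmod (taylor_coeff f n))\<^sup>2)"
  using bounded_imp_summable[of "\<lambda>n. (cmod (taylor_coeff f n))\<^sup>2" "(hardy2_norm f)\<^sup>2"]
    hardy2_coeff_sum_le[OF assms, of "Suc _"] by (simp add: lessThan_Suc_atMost)

lemma hardy2_of_square_summable:
  assumes f: "f holomorphic_on unit_disc" "\<And>z. z \<notin> unit_disc \<Longrightarrow> f z = 0"
    and sums: "\<And>z. z \<in> unit_disc \<Longrightarrow> (\<lambda>n. a n * z ^ n) sums f z"
    and summ: "summable (\<lambda>n. (cmod (a n))\<^sup>2)"
  shows "f \<in> hardy2" and "hardy2_norm f \<le> sqrt (\<Sum>n. (cmod (a n))\<^sup>2)"
proof -
  have *: "circle_mean f r \<le> (\<Sum>n. (cmod (a n))\<^sup>2)" if r: "0 \<le> r" "r < 1" for r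
  proof (rule sums_le[OF _ parseval_circle_mean[OF sums r] summable_sums[OF summ]])
    show "(cmod (a n))\<^sup>2 * (r ^ n)\<^sup>2 \<le> (cmod (a n))\<^sup>2" for n
      using r by (simp add: mult_left_le power_le_one)
  qed
  show "f \<in> hardy2" "hardy2_norm f \<le> sqrt (\<Sum>n. (cmod (a n))\<^sup>2)"
    using hardy2I[OF f *] by auto
qed

lemma hardy2_pointwise_bound:
  assumes f: "f \<in> hardy2" and z: "z \<in> unit_disc"
  shows "cmod (f z) \<le> hardy2_norm f / (1 - cmod z)"
proof -
  have coeff: "cmod (taylor_coeff f n) \<le> hardy2_norm f" for n
  proof -
    have "(cmod (taylor_coeff f n))\<^sup>2 \<le> (\<Sum>n<Suc n. (cmod (taylor_coeff f n))\<^sup>2)"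
      by (rule member_le_sum) auto
    also have "\<dots> \<le> (hardy2_norm f)\<^sup>2" by (rule hardy2_coeff_sum_le[OF f])
    finally show ?thesis using hardy2_norm_nonneg[OF f] by (rule power2_le_imp_le)
  qed
  have geo: "(\<lambda>n. hardy2_norm f * cmod z ^ n) sums (hardy2_norm f * (1 / (1 - cmod z)))"
    using z by (intro sums_mult geometric_sums) auto
  have "cmod (\<Sum>n. taylor_coeff f n * z ^ n) \<le> (\<Sum>n. hardy2_norm f * cmod z ^ n)"
    using coeff by (intro norm_suminf_le sums_summable[OF geo])
      (simp add: norm_mult norm_power mult_right_mono)
  then show ?thesis
    using sums_unique[OF geo] sums_unique[OF taylor_sums[OF hardy2_holomorphic[OF f] z]] by simp
qed

section \<open>Bounded functionals on the Hardy space\<close>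

definition bounded_functional_hardy2 :: "((complex \<Rightarrow> complex) \<Rightarrow> complex) \<Rightarrow> bool"
  where "bounded_functional_hardy2 L \<longleftrightarrow>
    (\<forall>f\<in>hardy2. \<forall>g\<in>hardy2. L (\<lambda>z. f z + g z) = L f + L g) \<and>
    (\<forall>c. \<forall>f\<in>hardy2. L (\<lambda>z. c * f z) = c * L f) \<and>
    (\<exists>K. \<forall>f\<in>hardy2. cmod (L f) \<le> K * hardy2_norm f)"

lemma bounded_functional_add:
  "bounded_functional_hardy2 L \<Longrightarrow> f \<in> hardy2 \<Longrightarrow> g \<in> hardy2 \<Longrightarrow> L (\<lambda>z. f z + g z) = L f + L g"
  by (simp add: bounded_functional_hardy2_def)

lemma bounded_functional_scale:
  "bounded_functional_hardy2 L \<Longrightarrow> f \<in> hardy2 \<Longrightarrow> L (\<lambda>z. c * f z) = c * L f"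
  by (simp add: bounded_functional_hardy2_def)

lemma bounded_functional_evaluation:
  assumes X: "bounded_operator_hardy2 X" and z: "z \<in> unit_disc"
  shows "bounded_functional_hardy2 (\<lambda>f. X f z)"
proof -
  obtain K where K: "\<And>f. f \<in> hardy2 \<Longrightarrow> hardy2_norm (X f) \<le> K * hardy2_norm f"
    using X unfolding bounded_operator_hardy2_def by blast
  have "cmod (X f z) \<le> K / (1 - cmod z) * hardy2_norm f" if f: "f \<in> hardy2" for f
  proof -
    have "X f \<in> hardy2" using X f unfolding bounded_operator_hardy2_def by blast
    then have "cmod (X f z) \<le> hardy2_norm (X f) / (1 - cmod z)"
      by (rule hardy2_pointwise_bound) (rule z)
    also have "\<dots> \<le> K * hardy2_norm f / (1 - cmod z)"
      using K[OF f] z by (intro divide_right_mono) auto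
    finally show ?thesis by simp
  qed
  moreover have "X (\<lambda>z. f z + g z) z = X f z + X g z" if "f \<in> hardy2" "g \<in> hardy2" for f g
  proof -
    have "X (\<lambda>z. f z + g z) = (\<lambda>z. X f z + X g z)"
      using X that unfolding bounded_operator_hardy2_def by blast
    then show ?thesis by simp
  qed
  moreover have "X (\<lambda>z. c * f z) z = c * X f z" if "f \<in> hardy2" for f c
  proof -
    have "X (\<lambda>z. c * f z) = (\<lambda>z. c * X f z)"
      using X that unfolding bounded_operator_hardy2_def by blast
    then show ?thesis by simp
  qed
  ultimately show ?thesis unfolding bounded_functional_hardy2_def by blast
qed

text \<open>
  The Taylor polynomials of \<open>f\<close> converge to \<open>f\<close> in norm, because the square of the norm of the
  remainder is a tail of the series of \<open>|a\<^sub>n|\<^sup>2\<close>; multiplication by \<open>b\<close> preserves this convergence.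
\<close>

lemma functional_zero_if_zero_on_bounded:
  assumes L: "bounded_functional_hardy2 L"
    and b: "b holomorphic_on unit_disc" "bounded (b ` unit_disc)"
    and zero: "\<And>p. p holomorphic_on unit_disc \<Longrightarrow> bounded (p ` unit_disc) \<Longrightarrow>
       L (toeplitz b (disc_restrict p)) = 0"
    and f: "f \<in> hardy2"
  shows "L (toeplitz b f) = 0"
proof -
  obtain B where B: "B \<ge> 0" "\<And>z. z \<in> unit_disc \<Longrightarrow> cmod (b z) \<le> B"
    using b(2) unfolding bounded_pos by (metis image_eqI less_imp_le)
  obtain K where K: "\<And>f. f \<in> hardy2 \<Longrightarrow> cmod (L f) \<le> K * hardy2_norm f"
    using L unfolding bounded_functional_hardy2_def by blast
  define a where "a = taylor_coeff f"
  define p where "p = (\<lambda>N z. \<Sum>n<N. a n * z ^ n)"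
  define d where "d = (\<lambda>N z. f z - disc_restrict (p N) z)"
  have p_holo: "p N holomorphic_on S" for N S
    unfolding p_def by (intro holomorphic_intros)
  have p_bdd: "bounded (p N ` unit_disc)" for N
  proof (rule bounded_subset[OF compact_imp_bounded])
    show "compact (p N ` cball 0 1)"
      by (intro compact_continuous_image holomorphic_on_imp_continuous_on p_holo compact_cball)
  qed auto
  have p_H: "disc_restrict (p N) \<in> hardy2" for N
    by (rule bounded_in_hardy2[OF p_holo p_bdd])
  have summ: "summable (\<lambda>n. (cmod (a n))\<^sup>2)"
    unfolding a_def by (rule hardy2_coeff_summable[OF f])
  define a' where "a' = (\<lambda>N n. if n < N then 0 else a n)"
  have d_holo: "d N holomorphic_on unit_disc" for N
    unfolding d_def by (intro holomorphic_intros hardy2_holomorphic f disc_restrict_holomorphic p_holo)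
  have d_out: "d N z = 0" if "z \<notin> unit_disc" for N z
    using hardy2_outside[OF f that] that by (simp add: d_def disc_restrict_def)
  have d_sums: "(\<lambda>n. a' N n * z ^ n) sums d N z" if z: "z \<in> unit_disc" for N z
  proof -
    have "(\<lambda>n. a n * z ^ n - (if n < N then a n * z ^ n else 0)) sums (f z - p N z)"
      unfolding a_def p_def
      by (intro sums_diff taylor_sums hardy2_holomorphic f z)
        (use sums_If_finite[of "\<lambda>n. n < N" "\<lambda>n. taylor_coeff f n * z ^ n"] in \<open>simp add: lessThan_def\<close>)
    moreover have "(\<lambda>n. a n * z ^ n - (if n < N then a n * z ^ n else 0)) = (\<lambda>n. a' N n * z ^ n)"
      by (auto simp: a'_def)
    ultimately show ?thesis using z by (simp add: d_def disc_restrict_def)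
  qed
  have a'_sums: "(\<lambda>n. (cmod (a' N n))\<^sup>2) sums ((\<Sum>n. (cmod (a n))\<^sup>2) - (\<Sum>n<N. (cmod (a n))\<^sup>2))" for N
  proof -
    have "(\<lambda>n. (cmod (a n))\<^sup>2 - (if n < N then (cmod (a n))\<^sup>2 else 0)) sums
        ((\<Sum>n. (cmod (a n))\<^sup>2) - (\<Sum>n<N. (cmod (a n))\<^sup>2))"
      by (intro sums_diff summable_sums summ)
        (use sums_If_finite[of "\<lambda>n. n < N" "\<lambda>n. (cmod (a n))\<^sup>2"] in \<open>simp add: lessThan_def\<close>)
    moreover have "(\<lambda>n. (cmod (a n))\<^sup>2 - (if n < N then (cmod (a n))\<^sup>2 else 0)) = (\<lambda>n. (cmod (a' N n))\<^sup>2)"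
      by (auto simp: a'_def)
    ultimately show ?thesis by simp
  qed
  have d_H: "d N \<in> hardy2"
    and d_norm: "hardy2_norm (d N) \<le> sqrt ((\<Sum>n. (cmod (a n))\<^sup>2) - (\<Sum>n<N. (cmod (a n))\<^sup>2))" for N
    using hardy2_of_square_summable[OF d_holo d_out d_sums sums_summable[OF a'_sums]]
    by (simp_all add: sums_unique[OF a'_sums, symmetric])
  have L_eq: "L (toeplitz b f) = L (toeplitz b (d N))" for N
  proof -
    have "toeplitz b f = (\<lambda>z. toeplitz b (d N) z + toeplitz b (disc_restrict (p N)) z)"
      by (simp add: toeplitz_def d_def algebra_simps)
    then have "L (toeplitz b f) = L (toeplitz b (d N)) + L (toeplitz b (disc_restrict (p N)))"
      using bounded_functional_add[OF L toeplitz_hardy2(1)[OF b(1) B d_H] toeplitz_hardy2(1)[OF b(1) B p_H]]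
      by simp
    then show ?thesis using zero[OF p_holo p_bdd] by simp
  qed
  have "cmod (L (toeplitz b f)) \<le> \<bar>K\<bar> * (B * sqrt ((\<Sum>n. (cmod (a n))\<^sup>2) - (\<Sum>n<N. (cmod (a n))\<^sup>2)))" for N
  proof -
    have "cmod (L (toeplitz b f)) \<le> K * hardy2_norm (toeplitz b (d N))"
      unfolding L_eq[of N] by (rule K[OF toeplitz_hardy2(1)[OF b(1) B d_H]])
    also have "\<dots> \<le> \<bar>K\<bar> * hardy2_norm (toeplitz b (d N))"
      by (intro mult_right_mono hardy2_norm_nonneg toeplitz_hardy2(1)[OF b(1) B d_H]) auto
    also have "\<dots> \<le> \<bar>K\<bar> * (B * hardy2_norm (d N))"
      by (intro mult_left_mono toeplitz_hardy2(2)[OF b(1) B d_H]) auto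
    also have "\<dots> \<le> \<bar>K\<bar> * (B * sqrt ((\<Sum>n. (cmod (a n))\<^sup>2) - (\<Sum>n<N. (cmod (a n))\<^sup>2)))"
      by (intro mult_left_mono d_norm B) auto
    finally show ?thesis .
  qed
  moreover have "(\<lambda>N. \<bar>K\<bar> * (B * sqrt ((\<Sum>n. (cmod (a n))\<^sup>2) - (\<Sum>n<N. (cmod (a n))\<^sup>2))))
      \<longlonglongrightarrow> \<bar>K\<bar> * (B * sqrt ((\<Sum>n. (cmod (a n))\<^sup>2) - (\<Sum>n. (cmod (a n))\<^sup>2)))"
    by (intro tendsto_intros summable_LIMSEQ summ)
  ultimately have "cmod (L (toeplitz b f)) \<le> \<bar>K\<bar> * (B * sqrt ((\<Sum>n. (cmod (a n))\<^sup>2) - (\<Sum>n. (cmod (a n))\<^sup>2)))"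
    by (intro LIMSEQ_le_const) auto
  then show ?thesis by simp
qed

section \<open>Growth of the logarithm of a univalent function\<close>

text \<open>
  If the derivative at \<open>z\<close> were larger, Bloch's theorem would put a disc of radius \<open>4 > \<pi>\<close> into the
  range of \<open>l\<close>. It contains two points whose difference is \<open>2 \<pi> \<i>\<close>, at which \<open>exp\<close> agrees.
  The constant is \<open>48 = 4 * 12\<close>, where \<open>1 / 12\<close> is the constant of Bloch's theorem.
\<close>

lemma log_of_univalent_deriv_bound:
  assumes l: "l holomorphic_on unit_disc" and inj: "inj_on (\<lambda>z. exp (l z)) unit_disc"
    and z: "z \<in> unit_disc"
  shows "cmod (deriv l z) \<le> 48 / (1 - cmod z)"
proof (rule ccontr)
  assume "\<not> ?thesis"
  then have big: "4 \<le> (1 - cmod z) * cmod (deriv l z) / 12"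
    using z by (simp add: field_simps)
  have sub: "ball z (1 - cmod z) \<subseteq> unit_disc"
    by (simp add: ball_subset_ball_iff)
  obtain b where b: "ball b 4 \<subseteq> l ` ball z (1 - cmod z)"
    by (rule Bloch[OF holomorphic_on_subset[OF l sub] _ big]) (use z in auto)
  have "b + \<i> * pi \<in> ball b 4" "b - \<i> * pi \<in> ball b 4"
    using pi_less_4 by (auto simp: dist_norm norm_mult)
  then have "b + \<i> * pi \<in> l ` unit_disc" "b - \<i> * pi \<in> l ` unit_disc"
    using b sub by blast+
  then obtain u v where uv: "u \<in> unit_disc" "l u = b + \<i> * pi" "v \<in> unit_disc" "l v = b - \<i> * pi"
    by auto
  have "exp (l u) = exp (l v)"
    unfolding uv by (simp add: exp_add exp_diff exp_pi_i')
  then have "u = v" using inj uv(1,3) by (auto dest: inj_onD)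
  then show False using uv(2,4) by simp
qed

text \<open>
  Integration of the derivative bound along the radius through \<open>z\<close>.
\<close>

lemma log_of_univalent_growth:
  assumes l: "l holomorphic_on unit_disc" and inj: "inj_on (\<lambda>z. exp (l z)) unit_disc"
    and z: "z \<in> unit_disc"
  shows "cmod (l z - l 0) \<le> - 48 * ln (1 - cmod z)"
proof -
  have in_disc: "of_real t * z \<in> unit_disc" and tz: "t * cmod z < 1" if "t \<in> {0..1}" for t :: real
  proof -
    have "t * cmod z \<le> 1 * cmod z" using that by (intro mult_right_mono) auto
    then show "t * cmod z < 1" using z by simp
    then show "of_real t * z \<in> unit_disc" using that by (simp add: norm_mult)
  qed
  have d: "((\<lambda>t. l (of_real t * z)) has_vector_derivative z * deriv l (of_real t * z)) (at t)"
    if "t \<in> {0..1}" for t :: real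
  proof -
    have "((\<lambda>w. l (w * z)) has_field_derivative deriv l (of_real t * z) * z) (at (of_real t))"
      by (rule DERIV_chain'[where g = l])
        (auto intro!: derivative_eq_intros holomorphic_derivI[OF l] in_disc[OF that])
    from has_vector_derivative_real_field[OF this] show ?thesis by (simp add: mult.commute)
  qed
  have d': "((\<lambda>t. - 48 * ln (1 - t * cmod z)) has_vector_derivative 48 * cmod z / (1 - t * cmod z)) (at t)"
    if "t \<in> {0..1}" for t :: real
    unfolding has_real_derivative_iff_has_vector_derivative[symmetric]
    using tz[OF that] by (auto intro!: derivative_eq_intros simp: field_simps)
  have "cmod (l (of_real 1 * z) - l (of_real 0 * z)) \<le> - 48 * ln (1 - 1 * cmod z) - - 48 * ln (1 - 0 * cmod z)"
  proof (rule differentiable_bound_general)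
    show "continuous_on {0..1} (\<lambda>t. l (of_real t * z))"
      using d by (intro continuous_on_vector_derivative[where f' = "\<lambda>t. z * deriv l (of_real t * z)"])
        (auto intro: has_vector_derivative_at_within)
    show "continuous_on {0..1} (\<lambda>t. - 48 * ln (1 - t * cmod z))"
      using d' by (intro continuous_on_vector_derivative[where f' = "\<lambda>t. 48 * cmod z / (1 - t * cmod z)"])
        (auto intro: has_vector_derivative_at_within)
    show "norm (z * deriv l (of_real t * z)) \<le> 48 * cmod z / (1 - t * cmod z)" if "0 < t" "t < 1" for t
    proof -
      have "cmod (deriv l (of_real t * z)) \<le> 48 / (1 - t * cmod z)"
        using log_of_univalent_deriv_bound[OF l inj in_disc, of t] that by (simp add: norm_mult)
      then have "cmod z * cmod (deriv l (of_real t * z)) \<le> cmod z * (48 / (1 - t * cmod z))"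
        by (rule mult_left_mono) simp
      then show ?thesis by (simp add: norm_mult mult_ac)
    qed
  qed (use d d' in auto)
  then show ?thesis by simp
qed

section \<open>Area estimates for univalent functions\<close>

text \<open>
  A discrete substitute for the formula of the area of the image as the integral of \<open>|f'|\<^sup>2\<close>: by
  Bloch's theorem the image of each disc contains a disc of radius \<open>\<rho> |f' (c j)| / 12\<close>. These are
  disjoint by injectivity and lie in the disc of radius \<open>M\<close>, so their total area is at most
  \<open>\<pi> M\<^sup>2\<close>.
\<close>

lemma disjoint_discs_derivative_sum:
  assumes f: "f holomorphic_on S" "inj_on f S" and fin: "finite J" and \<rho>: "\<rho> > 0"
    and sub: "\<And>j. j \<in> J \<Longrightarrow> ball (c j) \<rho> \<subseteq> S"
    and disj: "disjoint_family_on (\<lambda>j. ball (c j) \<rho>) J"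
    and M: "M \<ge> 0" "\<And>j w. j \<in> J \<Longrightarrow> w \<in> ball (c j) \<rho> \<Longrightarrow> cmod (f w) \<le> M"
  shows "(\<Sum>j\<in>J. (cmod (deriv f (c j)))\<^sup>2) \<le> (12 * M / \<rho>)\<^sup>2"
proof -
  have "\<exists>b. ball b (\<rho> * cmod (deriv f (c j)) / 12) \<subseteq> f ` ball (c j) \<rho>" if "j \<in> J" for j
    using Bloch[OF holomorphic_on_subset[OF f(1) sub[OF that]] \<rho> order_refl] by blast
  then obtain b where b: "\<And>j. j \<in> J \<Longrightarrow> ball (b j) (\<rho> * cmod (deriv f (c j)) / 12) \<subseteq> f ` ball (c j) \<rho>"
    by metis
  define D where "D = (\<lambda>j. ball (b j) (\<rho> * cmod (deriv f (c j)) / 12))"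
  have D_sub: "D j \<subseteq> f ` ball (c j) \<rho>" if "j \<in> J" for j using b[OF that] by (simp add: D_def)
  have "disjoint_family_on D J"
  proof -
    have "D i \<inter> D j = {}" if "i \<in> J" "j \<in> J" "i \<noteq> j" for i j
    proof -
      have "f ` ball (c i) \<rho> \<inter> f ` ball (c j) \<rho> = f ` (ball (c i) \<rho> \<inter> ball (c j) \<rho>)"
        using inj_on_image_Int[OF f(2) sub[OF that(1)] sub[OF that(2)]] by simp
      also have "\<dots> = {}" using disj that unfolding disjoint_family_on_def by auto
      finally show ?thesis using D_sub[OF that(1)] D_sub[OF that(2)] by blast
    qed
    then show ?thesis unfolding disjoint_family_on_def by blast
  qed
  then have "measure lborel (\<Union>j\<in>J. D j) = (\<Sum>j\<in>J. measure lborel (D j))"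
    using emeasure_lborel_ball_finite by (intro measure_finite_Union fin) (auto simp: D_def less_top)
  moreover have "measure lborel (\<Union>j\<in>J. D j) \<le> measure lborel (cball (0::complex) M)"
  proof (rule measure_mono_fmeasurable)
    show "(\<Union>j\<in>J. D j) \<subseteq> cball 0 M"
    proof
      fix x assume "x \<in> (\<Union>j\<in>J. D j)"
      then obtain j where j: "j \<in> J" "x \<in> D j" by blast
      then obtain w where "w \<in> ball (c j) \<rho>" "x = f w"
        using D_sub[OF j(1)] by blast
      then show "x \<in> cball 0 M" using M(2)[OF j(1)] by simp
    qed
    show "(\<Union>j\<in>J. D j) \<in> sets lborel"
      unfolding D_def by (intro sets.finite_UN fin) simp
    show "cball (0::complex) M \<in> fmeasurable lborel"
      using emeasure_lborel_cball_finite[of "0::complex" M] by (intro fmeasurableI) (simp_all add: less_top)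
  qed
  moreover have "measure lborel (cball (0::complex) M) = pi * M\<^sup>2"
    using M(1) by (simp add: content_cball unit_ball_vol_2)
  moreover have "measure lborel (D j) = pi * (\<rho> * cmod (deriv f (c j)) / 12)\<^sup>2" for j
    using \<rho> by (simp add: D_def content_ball unit_ball_vol_2)
  ultimately have "pi * (\<Sum>j\<in>J. (\<rho> * cmod (deriv f (c j)) / 12)\<^sup>2) \<le> pi * M\<^sup>2"
    by (simp add: sum_distrib_left)
  then have "(\<Sum>j\<in>J. (\<rho> * cmod (deriv f (c j)) / 12)\<^sup>2) \<le> M\<^sup>2" by simp
  moreover have "(\<Sum>j\<in>J. (\<rho> * cmod (deriv f (c j)) / 12)\<^sup>2)
      = (\<rho> / 12)\<^sup>2 * (\<Sum>j\<in>J. (cmod (deriv f (c j)))\<^sup>2)"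
    by (simp add: sum_distrib_left power_mult_distrib power_divide)
  ultimately show ?thesis
    using \<rho> by (simp add: power_mult_distrib power_divide field_simps)
qed

text \<open>
  On the block \<open>2\<^sup>i < n \<le> 2\<^sup>i\<^sup>+\<^sup>1\<close> the weight \<open>n\<^sup>2\<close> is at least \<open>4\<^sup>i\<close>, while the weighted sum is of order
  \<open>2\<^sup>3\<^sup>i\<^sup>/\<^sup>2\<close>, so the blocks of \<open>b\<close> are dominated by a geometric series.
\<close>

lemma summable_of_dyadic_growth:
  fixes b :: "nat \<Rightarrow> real"
  assumes nonneg: "\<And>n. b n \<ge> 0"
    and growth: "\<And>m. m \<ge> 1 \<Longrightarrow> (\<Sum>n=1..m. (real n)\<^sup>2 * b n) \<le> C * (real m * sqrt (real m))"
  shows "summable b"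
proof -
  define q where "q = sqrt 2 / 2"
  have q: "q < 1" using sqrt2_less_2 by (simp add: q_def)
  \<comment> \<open>\<open>D * q ^ i\<close> is the tail from \<open>i\<close> on of the geometric series that bounds the blocks; adding it
    to the partial sum gives a decreasing quantity.\<close>
  define D where "D = 2 * sqrt 2 * C / (1 - q)"
  have C: "C \<ge> 0" using growth[of 1] nonneg[of 1] by simp
  have block: "(\<Sum>n\<in>{2^i<..2^Suc i}. b n) \<le> 2 * sqrt 2 * C * q ^ i" for i
  proof -
    have "4 ^ i * (\<Sum>n\<in>{2^i<..2^Suc i}. b n) = (\<Sum>n\<in>{2^i<..2^Suc i}. (real (2^i))\<^sup>2 * b n)"
      by (simp add: sum_distrib_left power2_eq_square flip: power_mult_distrib)
    also have "\<dots> \<le> (\<Sum>n\<in>{2^i<..2^Suc i}. (real n)\<^sup>2 * b n)"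
    proof (rule sum_mono)
      fix n assume "n \<in> {2 ^ i<..(2::nat) ^ Suc i}"
      then have "2 ^ i \<le> n" by simp
      then have "real (2 ^ i) \<le> real n" by (rule of_nat_mono)
      then show "(real (2 ^ i))\<^sup>2 * b n \<le> (real n)\<^sup>2 * b n"
        by (intro mult_right_mono power_mono nonneg) auto
    qed
    also have "\<dots> \<le> (\<Sum>n=1..2^Suc i. (real n)\<^sup>2 * b n)"
      by (intro sum_mono2) (auto simp: nonneg)
    also have "\<dots> \<le> C * (real (2 ^ Suc i) * sqrt (real (2 ^ Suc i)))"
      by (rule growth) simp
    also have "\<dots> = 4 ^ i * (2 * sqrt 2 * C * q ^ i)"
    proof -
      have "(4::real) ^ i = 2 ^ i * 2 ^ i" by (simp flip: power_mult_distrib)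
      then show ?thesis by (simp add: q_def power_divide real_sqrt_mult real_sqrt_power)
    qed
    finally show ?thesis by simp
  qed
  have bound: "(\<Sum>n=1..2^i. b n) + D * q ^ i \<le> b 1 + D" for i
  proof (induction i)
    case (Suc i)
    have "{1..2^Suc i} = {1..2^i} \<union> {2^i<..(2::nat)^Suc i}" by auto
    then have "(\<Sum>n=1..2^Suc i. b n) = (\<Sum>n=1..2^i. b n) + (\<Sum>n\<in>{2^i<..2^Suc i}. b n)"
      by (simp only:) (rule sum.union_disjoint, auto)
    also have "\<dots> \<le> (\<Sum>n=1..2^i. b n) + 2 * sqrt 2 * C * q ^ i" using block by simp
    finally have "(\<Sum>n=1..2^Suc i. b n) \<le> (\<Sum>n=1..2^i. b n) + 2 * sqrt 2 * C * q ^ i" .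
    moreover have "2 * sqrt 2 * C = D * (1 - q)" using q by (simp add: D_def)
    ultimately have "(\<Sum>n=1..2^Suc i. b n) \<le> (\<Sum>n=1..2^i. b n) + D * (1 - q) * q ^ i" by simp
    then show ?case using Suc by (simp add: algebra_simps)
  qed simp
  have "D \<ge> 0" "q \<ge> 0" using C q by (auto simp: D_def q_def)
  then have le: "(\<Sum>n=1..2^i. b n) \<le> b 1 + D" for i
    using bound[of i] by (smt (verit) mult_nonneg_nonneg zero_le_power)
  have "(\<Sum>n\<le>N. b n) \<le> b 0 + (b 1 + D)" for N
  proof -
    have "(\<Sum>n\<le>N. b n) = b 0 + (\<Sum>n=1..N. b n)"
      by (simp add: atMost_atLeast0 sum.atLeast_Suc_atMost)
    also have "(\<Sum>n=1..N. b n) \<le> (\<Sum>n=1..2^N. b n)"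
      using less_exp[of N] by (intro sum_mono2) (auto simp: nonneg)
    finally show ?thesis using le[of N] by simp
  qed
  then show ?thesis by (intro bounded_imp_summable[OF nonneg])
qed

lemma circle_mean_rotate:
  assumes f: "f holomorphic_on unit_disc" and \<zeta>: "cmod \<zeta> = 1" and r: "0 \<le> r" "r < 1"
  shows "circle_mean (\<lambda>z. f (\<zeta> * z)) r = circle_mean f r"
proof -
  have "(\<lambda>n. (cmod (taylor_coeff f n * \<zeta> ^ n))\<^sup>2 * (r ^ n)\<^sup>2) sums circle_mean (\<lambda>z. f (\<zeta> * z)) r"
  proof (rule parseval_circle_mean[OF _ r])
    fix z assume "z \<in> unit_disc"
    then have "\<zeta> * z \<in> unit_disc" using \<zeta> by (simp add: norm_mult)
    from taylor_sums[OF f this] show "(\<lambda>n. taylor_coeff f n * \<zeta> ^ n * z ^ n) sums f (\<zeta> * z)"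
      by (simp add: power_mult_distrib mult.assoc)
  qed
  moreover have "(\<lambda>n. (cmod (taylor_coeff f n))\<^sup>2 * (r ^ n)\<^sup>2) sums circle_mean f r"
    by (rule parseval_circle_mean[OF taylor_sums[OF f] r])
  ultimately show ?thesis
    using \<zeta> by (simp add: norm_mult norm_power sums_unique2)
qed

text \<open>
  The area estimate controls the sum of \<open>|P'|\<^sup>2\<close> over \<open>m\<close> separated points of the circle of radius
  \<open>1 - 1 / (2 m)\<close>. Rotating these points and averaging over all rotations turns the sum into \<open>m\<close>
  times the mean over the circle.
\<close>

lemma deriv_circle_mean_bound_of_univalent:
  assumes P: "P holomorphic_on unit_disc" "inj_on P unit_disc"
    and growth: "\<And>z. z \<in> unit_disc \<Longrightarrow> (cmod (P z))\<^sup>2 \<le> C / sqrt (1 - cmod z)"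
    and m: "m \<ge> 1"
  shows "circle_mean (deriv P) (1 - 1 / (2 * real m)) \<le> 4608 * C * (real m * sqrt (real m))"
proof -
  define r where "r = 1 - 1 / (2 * real m)"
  define \<rho> where "\<rho> = 1 / (4 * real m)"
  \<comment> \<open>The \<open>m\<close> points are chosen on the unit circle with imaginary parts \<open>j / m\<close>, which makes
    their separation by \<open>1 / m\<close> immediate. The average over rotations gives the same mean for
    every point of the unit circle.\<close>
  define \<zeta> where "\<zeta> = (\<lambda>j::nat. Complex (sqrt (1 - (real j / real m)\<^sup>2)) (real j / real m))"
  define M where "M = sqrt (2 * C * sqrt (real m))"
  have r: "1 / 2 \<le> r" "r < 1" using m by (auto simp: r_def field_simps)
  have \<rho>: "\<rho> > 0" "r + \<rho> = 1 - \<rho>" "2 * \<rho> = 1 / (2 * real m)"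
    using m by (auto simp: r_def \<rho>_def field_simps)
  have C: "C \<ge> 0" using order_trans[OF zero_le_power2 growth[of 0]] by simp
  have norm_\<zeta>: "cmod (\<zeta> j) = 1" if "j < m" for j
  proof -
    have "(real j / real m)\<^sup>2 \<le> 1" using that by (intro power_le_one) auto
    then show ?thesis by (simp add: \<zeta>_def cmod_def)
  qed
  have dist_\<zeta>: "1 / real m \<le> cmod (\<zeta> j - \<zeta> k)" if "j \<noteq> k" for j k
  proof -
    have "1 \<le> \<bar>real j - real k\<bar>" using that by linarith
    then have "1 / real m \<le> \<bar>real j - real k\<bar> / real m" by (rule divide_right_mono) simp
    also have "\<dots> = \<bar>Im (\<zeta> j - \<zeta> k)\<bar>" by (simp add: \<zeta>_def diff_divide_distrib[symmetric])
    also have "\<dots> \<le> cmod (\<zeta> j - \<zeta> k)" by (rule abs_Im_le_cmod)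
    finally show ?thesis .
  qed
  have pointwise: "(\<Sum>j<m. (cmod (deriv P (\<zeta> j * (of_real r * cis t))))\<^sup>2)
      \<le> 4608 * C * ((real m)\<^sup>2 * sqrt (real m))" for t
  proof -
    define c where "c = (\<lambda>j. \<zeta> j * (of_real r * cis t))"
    have norm_c: "cmod (c j) = r" if "j < m" for j
      using norm_\<zeta>[OF that] r by (simp add: c_def norm_mult)
    have dist_c: "2 * \<rho> \<le> dist (c j) (c k)" if "j \<noteq> k" for j k
    proof -
      have "2 * \<rho> = 1 / 2 * (1 / real m)" using \<rho>(3) by simp
      also have "\<dots> \<le> r * cmod (\<zeta> j - \<zeta> k)"
        using r dist_\<zeta>[OF that] by (intro mult_mono) auto
      also have "\<dots> = dist (c j) (c k)"
        using r by (simp add: c_def dist_norm norm_mult flip: left_diff_distrib)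
      finally show ?thesis .
    qed
    have norm_w: "cmod w < 1 - \<rho>" if "j < m" "w \<in> ball (c j) \<rho>" for j w
    proof -
      have "cmod w \<le> cmod (c j) + dist (c j) w"
        using norm_triangle_ineq2[of w "c j"] by (simp add: dist_norm norm_minus_commute)
      then show ?thesis using norm_c[OF that(1)] that(2) \<rho>(2) by simp
    qed
    have "(\<Sum>j\<in>{..<m}. (cmod (deriv P (c j)))\<^sup>2) \<le> (12 * M / \<rho>)\<^sup>2"
    proof (rule disjoint_discs_derivative_sum[OF P])
      show "ball (c j) \<rho> \<subseteq> unit_disc" if "j \<in> {..<m}" for j
      proof
        fix w assume "w \<in> ball (c j) \<rho>"
        then show "w \<in> unit_disc" using norm_w[of j w] that \<rho>(1) by simp
      qed
      show "disjoint_family_on (\<lambda>j. ball (c j) \<rho>) {..<m}"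
        unfolding disjoint_family_on_def
      proof (intro ballI impI)
        fix j k :: nat assume "j \<noteq> k"
        then show "ball (c j) \<rho> \<inter> ball (c k) \<rho> = {}"
          using dist_c by (intro disjoint_ballI) auto
      qed
      show "cmod (P w) \<le> M" if "j \<in> {..<m}" "w \<in> ball (c j) \<rho>" for j w
      proof -
        have w: "cmod w < 1 - \<rho>" using norm_w that by auto
        have "(cmod (P w))\<^sup>2 \<le> C / sqrt (1 - cmod w)" using w \<rho>(1) by (intro growth) simp
        also have "\<dots> \<le> C / sqrt \<rho>"
          using w \<rho>(1) C by (intro divide_left_mono) auto
        also have "\<dots> = 2 * C * sqrt (real m)"
          by (simp add: \<rho>_def real_sqrt_divide real_sqrt_mult)
        finally show ?thesis unfolding M_def by (rule real_le_rsqrt)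
      qed
    qed (use \<rho> C in \<open>auto simp: M_def\<close>)
    also have "(12 * M / \<rho>)\<^sup>2 = 4608 * C * ((real m)\<^sup>2 * sqrt (real m))"
      using C by (simp add: M_def \<rho>_def power_mult_distrib)
    finally show ?thesis by (simp add: c_def)
  qed
  have holo: "deriv P holomorphic_on unit_disc"
    by (intro holomorphic_deriv P) simp
  have rot_holo: "(\<lambda>z. deriv P (\<zeta> j * z)) holomorphic_on unit_disc" if "j < m" for j
  proof -
    have "(\<lambda>z. \<zeta> j * z) ` unit_disc \<subseteq> unit_disc"
      using norm_\<zeta>[OF that] by (auto simp: norm_mult)
    with holomorphic_on_compose_gen[OF _ holo, of "\<lambda>z. \<zeta> j * z"] show ?thesis
      unfolding o_def by (auto intro: holomorphic_intros)
  qed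
  have int: "(\<lambda>t. (cmod (deriv P (\<zeta> j * (of_real r * cis t))))\<^sup>2) integrable_on {0..2*pi}" if "j < m" for j
    using circle_mean_integrable[OF rot_holo[OF that]] r by simp
  have "real m * circle_mean (deriv P) r = (\<Sum>j<m. circle_mean (\<lambda>z. deriv P (\<zeta> j * z)) r)"
    using r by (simp add: circle_mean_rotate[OF holo norm_\<zeta>])
  also have "\<dots> = 1 / (2 * pi) * integral {0..2*pi}
      (\<lambda>t. \<Sum>j<m. (cmod (deriv P (\<zeta> j * (of_real r * cis t))))\<^sup>2)"
    unfolding circle_mean_def sum_distrib_left[symmetric] by (subst integral_sum) (auto intro: int)
  also have "\<dots> \<le> 1 / (2 * pi) * integral {0..2*pi} (\<lambda>t. 4608 * C * ((real m)\<^sup>2 * sqrt (real m)))"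
    using int pointwise by (intro mult_left_mono integral_le integrable_sum) auto
  also have "\<dots> = real m * (4608 * C * (real m * sqrt (real m)))"
    by (simp add: power2_eq_square)
  finally show ?thesis using m unfolding r_def by simp
qed

text \<open>
  For \<open>n < m\<close> and \<open>r = 1 - 1 / (2 m)\<close> the factor \<open>r\<^sup>2\<^sup>n\<close> in Parseval's identity is at least \<open>1 / 4\<close>, so
  the bound on the mean of \<open>|P'|\<^sup>2\<close> bounds the sum of \<open>n\<^sup>2 |a\<^sub>n|\<^sup>2\<close> for \<open>n \<le> m\<close>.
\<close>

lemma univalent_in_hardy2_of_growth:
  assumes P: "P holomorphic_on unit_disc" "inj_on P unit_disc"
    and growth: "\<And>z. z \<in> unit_disc \<Longrightarrow> (cmod (P z))\<^sup>2 \<le> C / sqrt (1 - cmod z)"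
  shows "disc_restrict P \<in> hardy2"
proof -
  define b where "b = (\<lambda>n. (cmod (taylor_coeff P n))\<^sup>2)"
  have holo: "deriv P holomorphic_on unit_disc"
    by (intro holomorphic_deriv P) simp
  have "(\<Sum>n=1..m. (real n)\<^sup>2 * b n) \<le> 18432 * C * (real m * sqrt (real m))" if m: "m \<ge> 1" for m
  proof -
    define r where "r = 1 - 1 / (2 * real m)"
    have r: "0 \<le> r" "r < 1" using m by (auto simp: r_def field_simps)
    have r_pow: "1 / 4 \<le> (r ^ n)\<^sup>2" if "n < m" for n
    proof -
      have "1 / 2 = 1 + real m * (- (1 / (2 * real m)))" using m by simp
      also have "\<dots> \<le> (1 + - (1 / (2 * real m))) ^ m"
        using m by (intro Bernoulli_inequality) (auto simp: field_simps)
      also have "\<dots> = r ^ m" by (simp add: r_def)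
      also have "\<dots> \<le> r ^ n" using r that by (intro power_decreasing) auto
      finally have "(1 / 2)\<^sup>2 \<le> (r ^ n)\<^sup>2" by (intro power_mono) auto
      then show ?thesis by (simp add: power2_eq_square)
    qed
    have ps: "(\<lambda>n. (cmod (taylor_coeff (deriv P) n))\<^sup>2 * (r ^ n)\<^sup>2) sums circle_mean (deriv P) r"
      by (rule parseval_circle_mean[OF taylor_sums[OF holo] r])
    have "(\<Sum>n=1..m. (real n)\<^sup>2 * b n) = (\<Sum>n<m. (real (Suc n))\<^sup>2 * b (Suc n))"
      by (rule sum.reindex_bij_witness[of _ Suc "\<lambda>n. n - 1"]) auto
    also have "\<dots> = (\<Sum>n<m. (cmod (taylor_coeff (deriv P) n))\<^sup>2)"
      by (simp only: taylor_coeff_deriv norm_mult power_mult_distrib norm_of_nat b_def)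
    also have "\<dots> \<le> (\<Sum>n<m. 4 * ((cmod (taylor_coeff (deriv P) n))\<^sup>2 * (r ^ n)\<^sup>2))"
    proof (rule sum_mono)
      fix n assume "n \<in> {..<m}"
      then have "(cmod (taylor_coeff (deriv P) n))\<^sup>2 * (1 / 4) \<le> (cmod (taylor_coeff (deriv P) n))\<^sup>2 * (r ^ n)\<^sup>2"
        by (intro mult_left_mono r_pow) auto
      then show "(cmod (taylor_coeff (deriv P) n))\<^sup>2 \<le> 4 * ((cmod (taylor_coeff (deriv P) n))\<^sup>2 * (r ^ n)\<^sup>2)"
        by simp
    qed
    also have "\<dots> = 4 * (\<Sum>n<m. (cmod (taylor_coeff (deriv P) n))\<^sup>2 * (r ^ n)\<^sup>2)"
      by (simp add: sum_distrib_left)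
    also have "\<dots> \<le> 4 * circle_mean (deriv P) r"
      unfolding sums_unique[OF ps]
      by (intro mult_left_mono sum_le_suminf sums_summable[OF ps]) auto
    also have "\<dots> \<le> 4 * (4608 * C * (real m * sqrt (real m)))"
      unfolding r_def by (intro mult_left_mono deriv_circle_mean_bound_of_univalent P growth m) auto
    finally show ?thesis by simp
  qed
  then have summ: "summable b"
    by (intro summable_of_dyadic_growth) (auto simp: b_def)
  show ?thesis
  proof (rule hardy2_of_square_summable(1))
    show "(\<lambda>n. taylor_coeff P n * z ^ n) sums disc_restrict P z" if "z \<in> unit_disc" for z
      using taylor_sums[OF P(1) that] that by (simp add: disc_restrict_def)
    show "disc_restrict P z = 0" if "z \<notin> unit_disc" for z
      using that by (simp add: disc_restrict_def)
  qed (use summ in \<open>simp_all add: b_def disc_restrict_holomorphic P\<close>)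
qed

section \<open>Univalent functions without zeros are cyclic\<close>

text \<open>
  For bounded \<open>p\<close> one has \<open>b p = (b Q) (P p)\<close> with \<open>P p\<close> in the Hardy space, and bounded functions
  are dense.
\<close>

lemma cancel_factor_in_annihilator:
  assumes L: "bounded_functional_hardy2 L"
    and b: "b holomorphic_on unit_disc" "bounded (b ` unit_disc)"
    and Q: "Q holomorphic_on unit_disc" "bounded (Q ` unit_disc)"
    and P: "disc_restrict P \<in> hardy2" and QP: "\<And>z. z \<in> unit_disc \<Longrightarrow> Q z * P z = 1"
    and zero: "\<And>f. f \<in> hardy2 \<Longrightarrow> L (toeplitz (\<lambda>z. b z * Q z) f) = 0"
    and f: "f \<in> hardy2"
  shows "L (toeplitz b f) = 0"
proof (rule functional_zero_if_zero_on_bounded[OF L b _ f])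
  fix p assume p: "p holomorphic_on unit_disc" "bounded (p ` unit_disc)"
  obtain B where B: "B \<ge> 0" "\<And>z. z \<in> unit_disc \<Longrightarrow> cmod (p z) \<le> B"
    using p(2) unfolding bounded_pos by (metis image_eqI less_imp_le)
  have "toeplitz p (disc_restrict P) \<in> hardy2"
    by (rule toeplitz_hardy2(1)[OF p(1) B P])
  moreover have "toeplitz b (disc_restrict p) = toeplitz (\<lambda>z. b z * Q z) (toeplitz p (disc_restrict P))"
    using QP by (auto simp: toeplitz_def disc_restrict_def fun_eq_iff)
  ultimately show "L (toeplitz b (disc_restrict p)) = 0" using zero by simp
qed

text \<open>
  This is the statement that \<open>F\<close> is outer, in the form that a functional annihilating its
  multiples vanishes. The exponent \<open>192 = 4 * 48\<close> is dictated by the logarithmic growth of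
  \<open>l = log F\<close>: with the constant \<open>48\<close> there, \<open>|exp (- l / 192)|\<^sup>2\<close> is of order at most
  \<open>(1 - |z|) powr (- 1 / 2)\<close>.
\<close>

lemma univalent_nonvanishing_cyclic:
  assumes F: "F holomorphic_on unit_disc" "bounded (F ` unit_disc)" "inj_on F unit_disc"
    and nz: "\<And>z. z \<in> unit_disc \<Longrightarrow> F z \<noteq> 0"
    and L: "bounded_functional_hardy2 L"
    and zero: "\<And>f. f \<in> hardy2 \<Longrightarrow> L (toeplitz F f) = 0"
    and f: "f \<in> hardy2"
  shows "L f = 0"
proof -
  obtain l where l: "l holomorphic_on unit_disc" and Fl: "\<And>z. z \<in> unit_disc \<Longrightarrow> F z = exp (l z)"
    by (rule contractible_imp_holomorphic_log[OF F(1) _ nz]) (auto intro: convex_imp_contractible)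
  have inj: "inj_on (\<lambda>z. exp (l z)) unit_disc"
    using F(3) Fl by (simp add: inj_on_def)
  define Q where "Q = (\<lambda>z. exp (l z / 192))"
  define P where "P = (\<lambda>z. exp (- l z / 192))"
  have Q: "Q holomorphic_on unit_disc" and P: "P holomorphic_on unit_disc"
    unfolding Q_def P_def by (intro holomorphic_intros l; simp)+
  have QP: "Q z * P z = 1" for z by (simp add: Q_def P_def flip: exp_add)
  have Q_pow: "Q z ^ 192 = F z" if "z \<in> unit_disc" for z
    using Fl[OF that] by (simp add: Q_def flip: exp_of_nat_mult)
  have P_inj: "inj_on P unit_disc"
  proof (rule inj_onI)
    fix u v assume uv: "u \<in> unit_disc" "v \<in> unit_disc" "P u = P v"
    then have "Q u = Q v" using QP[of u] QP[of v] by (metis mult_cancel_right mult_zero_right zero_neq_one)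
    then have "F u = F v" using Q_pow uv by metis
    then show "u = v" using F(3) uv by (auto dest: inj_onD)
  qed
  have Q_bdd: "bounded ((\<lambda>z. Q z ^ k) ` unit_disc)" for k
  proof -
    obtain B where B: "B > 0" "\<And>z. z \<in> unit_disc \<Longrightarrow> cmod (F z) \<le> B"
      using F(2) unfolding bounded_pos by auto
    have "cmod (Q z ^ k) \<le> (max B 1) ^ k" if "z \<in> unit_disc" for z
    proof -
      \<comment> \<open>The maximum with \<open>1\<close> provides a bound that is at most its own 192nd power.\<close>
      have "cmod (Q z) ^ 192 \<le> max B 1"
        using B(2)[OF that] Q_pow[OF that] by (metis norm_power max.coboundedI1)
      also have "\<dots> \<le> max B 1 ^ 192" by (rule self_le_power) auto
      finally have "cmod (Q z) \<le> max B 1"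
        by (rule power_le_imp_le_base[of _ 191, simplified]) auto
      then show ?thesis by (simp add: norm_power power_mono)
    qed
    then show ?thesis unfolding bounded_iff by blast
  qed
  have P_H: "disc_restrict P \<in> hardy2"
  proof (rule univalent_in_hardy2_of_growth[OF P P_inj])
    fix z :: complex assume z: "z \<in> unit_disc"
    have "(cmod (P z))\<^sup>2 = exp (- Re (l z) / 96)"
      by (simp add: P_def flip: exp_double)
    also have "\<dots> \<le> exp (cmod (l 0) / 96 + (- 48 * ln (1 - cmod z)) / 96)"
    proof -
      have "- Re (l z) \<le> cmod (l z)" using abs_Re_le_cmod[of "l z"] by linarith
      also have "\<dots> \<le> cmod (l 0) + cmod (l z - l 0)" by (rule norm_triangle_sub)
      also have "\<dots> \<le> cmod (l 0) + - 48 * ln (1 - cmod z)"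
        using log_of_univalent_growth[OF l inj z] by simp
      finally show ?thesis by simp
    qed
    also have "\<dots> = exp (cmod (l 0) / 96) * exp (- (ln (1 - cmod z) / 2))"
      by (simp flip: exp_add)
    also have "exp (- (ln (1 - cmod z) / 2)) = 1 / sqrt (1 - cmod z)"
      using z by (simp add: exp_minus ln_sqrt[symmetric] inverse_eq_divide)
    finally show "(cmod (P z))\<^sup>2 \<le> exp (cmod (l 0) / 96) / sqrt (1 - cmod z)" by simp
  qed
  have "\<forall>f\<in>hardy2. L (toeplitz (\<lambda>z. Q z ^ (192 - k)) f) = 0" if "k \<le> 192" for k
    using that
  proof (induction k)
    case 0
    have "toeplitz (\<lambda>z. Q z ^ 192) f = toeplitz F f" if "f \<in> hardy2" for f
      unfolding toeplitz_def using Q_pow hardy2_outside[OF that] by (metis mult_zero_right)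
    then show ?case using zero by simp
  next
    case (Suc k)
    have eq: "Q z ^ (192 - Suc k) * Q z = Q z ^ (192 - k)" for z
    proof -
      have "192 - k = Suc (192 - Suc k)" using Suc.prems by simp
      then show ?thesis by (simp add: mult.commute)
    qed
    show ?case
    proof
      fix f assume f: "f \<in> hardy2"
      show "L (toeplitz (\<lambda>z. Q z ^ (192 - Suc k)) f) = 0"
      proof (rule cancel_factor_in_annihilator[OF L _ Q_bdd Q _ P_H QP _ f])
        show "(\<lambda>z. Q z ^ (192 - Suc k)) holomorphic_on unit_disc"
          by (intro holomorphic_intros Q)
        show "bounded (Q ` unit_disc)" using Q_bdd[of 1] by simp
        show "L (toeplitz (\<lambda>z. Q z ^ (192 - Suc k) * Q z) g) = 0" if "g \<in> hardy2" for g
          unfolding eq using Suc that by simp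
      qed
    qed
  qed
  from this[of 192] f show ?thesis by (simp add: toeplitz_def)
qed

section \<open>Eigenfunctionals of multiplication by a univalent function\<close>

lemma one_in_hardy2: "disc_restrict (\<lambda>z. 1) \<in> hardy2"
  by (rule bounded_in_hardy2) (auto intro: finite_imp_bounded finite_subset[of _ "{1}"])

text \<open>
  Both \<open>f - f w\<close> and \<open>\<phi> - \<phi> w\<close> are divisible by \<open>z - w\<close>, and the second quotient has no zero since
  \<open>\<phi>\<close> is injective, also at \<open>w\<close> where it is \<open>\<phi>' w\<close>. Near \<open>w\<close> the result is bounded by compactness.
  Away from \<open>w\<close>, injectivity keeps \<open>\<phi>\<close> outside a neighbourhood of \<open>\<phi> w\<close>, namely one that is covered
  by the image of a small disc about \<open>w\<close>, so there the result is dominated by \<open>f\<close>.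
\<close>

lemma divide_by_univalent_in_hardy2:
  assumes \<phi>: "\<phi> holomorphic_on unit_disc" "inj_on \<phi> unit_disc"
    and f: "f \<in> hardy2" and w: "w \<in> unit_disc"
  obtains g where "g \<in> hardy2" "\<And>z. z \<in> unit_disc \<Longrightarrow> f z - f w = (\<phi> z - \<phi> w) * g z"
proof -
  define df where "df = (\<lambda>z. if z = w then deriv f w else (f z - f w) / (z - w))"
  define d\<phi> where "d\<phi> = (\<lambda>z. if z = w then deriv \<phi> w else (\<phi> z - \<phi> w) / (z - w))"
  have holo: "df holomorphic_on unit_disc" "d\<phi> holomorphic_on unit_disc"
    unfolding df_def d\<phi>_def
    by (intro pole_lemma_open hardy2_holomorphic f \<phi>(1) open_ball)+
  have nz: "d\<phi> z \<noteq> 0" if "z \<in> unit_disc" for z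
    using holomorphic_injective_imp_regular[OF \<phi>(1) open_ball \<phi>(2) w] inj_onD[OF \<phi>(2) _ that w]
    by (auto simp: d\<phi>_def)
  define g where "g = disc_restrict (\<lambda>z. df z / d\<phi> z)"
  have g_holo: "g holomorphic_on unit_disc"
    unfolding g_def by (intro disc_restrict_holomorphic holomorphic_intros holo nz)
  have fact: "f z - f w = (\<phi> z - \<phi> w) * g z" if "z \<in> unit_disc" for z
    using nz[OF that] that by (auto simp: g_def disc_restrict_def df_def d\<phi>_def split: if_splits)
  obtain \<delta> where \<delta>: "\<delta> > 0" "cball w \<delta> \<subseteq> unit_disc"
    using open_contains_cball[of unit_disc] w by blast
  have "open (\<phi> ` ball w \<delta>)"
  proof (rule open_mapping_thm3)
    have "ball w \<delta> \<subseteq> unit_disc" using \<delta>(2) ball_subset_cball by blast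
    then show "\<phi> holomorphic_on ball w \<delta>" "inj_on \<phi> (ball w \<delta>)"
      using \<phi> by (blast intro: holomorphic_on_subset inj_on_subset)+
  qed simp
  then obtain \<epsilon> where \<epsilon>: "\<epsilon> > 0" "ball (\<phi> w) \<epsilon> \<subseteq> \<phi> ` ball w \<delta>"
    using \<delta>(1) open_contains_ball_eq by (metis centre_in_ball imageI)
  have far: "\<epsilon> \<le> cmod (\<phi> z - \<phi> w)" if "z \<in> unit_disc" "z \<notin> ball w \<delta>" for z
  proof (rule ccontr)
    assume "\<not> ?thesis"
    then have "\<phi> z \<in> \<phi> ` ball w \<delta>" using \<epsilon>(2) by (auto simp: dist_norm norm_minus_commute)
    then show False using inj_onD[OF \<phi>(2)] that \<delta>(2) by (metis ball_subset_cball imageE subsetD)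
  qed
  have "compact (g ` cball w \<delta>)"
    using \<delta>(2) by (intro compact_continuous_image compact_cball
        continuous_on_subset[OF holomorphic_on_imp_continuous_on[OF g_holo]])
  then have "bounded (g ` cball w \<delta>)" by (rule compact_imp_bounded)
  then obtain M where M: "\<And>z. z \<in> cball w \<delta> \<Longrightarrow> cmod (g z) \<le> M"
    unfolding bounded_iff by blast
  have dom: "(cmod (g z))\<^sup>2 \<le> (M\<^sup>2 + 2 * (cmod (f w))\<^sup>2 / \<epsilon>\<^sup>2) + 2 / \<epsilon>\<^sup>2 * (cmod (f z))\<^sup>2"
    if z: "z \<in> unit_disc" for z
  proof (cases "z \<in> ball w \<delta>")
    case True
    then have "(cmod (g z))\<^sup>2 \<le> M\<^sup>2" using M[of z] by (intro power_mono) auto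
    then show ?thesis by (simp add: add.assoc add_increasing2)
  next
    case False
    have "\<epsilon> * cmod (g z) \<le> cmod (\<phi> z - \<phi> w) * cmod (g z)"
      by (intro mult_right_mono far z False) auto
    also have "\<dots> = cmod (f z - f w)" using fact[OF z] by (simp add: norm_mult)
    also have "\<dots> \<le> cmod (f z) + cmod (f w)" by (rule norm_triangle_ineq4)
    finally have "(\<epsilon> * cmod (g z))\<^sup>2 \<le> (cmod (f z) + cmod (f w))\<^sup>2"
      using \<epsilon>(1) by (intro power_mono) auto
    also have "\<dots> \<le> 2 * (cmod (f w))\<^sup>2 + 2 * (cmod (f z))\<^sup>2"
      using sum_squares_bound[of "cmod (f z)" "cmod (f w)"] by (simp add: power2_sum)
    finally have "(cmod (g z))\<^sup>2 \<le> (2 * (cmod (f w))\<^sup>2 + 2 * (cmod (f z))\<^sup>2) / \<epsilon>\<^sup>2"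
      using \<epsilon>(1) by (simp add: field_simps power_mult_distrib)
    also have "\<dots> = 2 * (cmod (f w))\<^sup>2 / \<epsilon>\<^sup>2 + 2 / \<epsilon>\<^sup>2 * (cmod (f z))\<^sup>2"
      by (simp add: add_divide_distrib)
    finally show ?thesis using zero_le_power2[of M] by linarith
  qed
  have "g \<in> hardy2"
    by (rule hardy2_dominated(1)[OF f g_holo _ _ dom]) (auto simp: g_def disc_restrict_def)
  then show ?thesis using that fact by blast
qed

lemma toeplitz_minus_const_in_kernel:
  assumes L: "bounded_functional_hardy2 L"
    and \<phi>: "\<phi> holomorphic_on unit_disc" "bounded (\<phi> ` unit_disc)"
    and eig: "\<And>f. f \<in> hardy2 \<Longrightarrow> L (toeplitz \<phi> f) = \<mu> * L f"
    and f: "f \<in> hardy2"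
  shows "L (toeplitz (\<lambda>z. \<phi> z - \<mu>) f) = 0"
proof -
  obtain B where B: "B \<ge> 0" "\<And>z. z \<in> unit_disc \<Longrightarrow> cmod (\<phi> z) \<le> B"
    using \<phi>(2) unfolding bounded_pos by (metis image_eqI less_imp_le)
  have \<phi>f: "toeplitz \<phi> f \<in> hardy2" by (rule toeplitz_hardy2(1)[OF \<phi>(1) B f])
  have cf: "(\<lambda>z. - \<mu> * f z) \<in> hardy2"
    using toeplitz_hardy2(1)[of "\<lambda>z. - \<mu>" "cmod \<mu>", OF _ _ _ f] by (simp add: toeplitz_def)
  have "toeplitz (\<lambda>z. \<phi> z - \<mu>) f = (\<lambda>z. toeplitz \<phi> f z + - \<mu> * f z)"
    by (simp add: toeplitz_def algebra_simps)
  moreover have "L (\<lambda>z. toeplitz \<phi> f z + - \<mu> * f z) = L (toeplitz \<phi> f) + L (\<lambda>z. - \<mu> * f z)"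
    by (rule bounded_functional_add[OF L \<phi>f cf])
  moreover have "L (\<lambda>z. - \<mu> * f z) = - \<mu> * L f"
    by (rule bounded_functional_scale[OF L f])
  ultimately show ?thesis using eig[OF f] by simp
qed

lemma eigenfunctional_in_range:
  assumes L: "bounded_functional_hardy2 L"
    and \<phi>: "\<phi> holomorphic_on unit_disc" "bounded (\<phi> ` unit_disc)" "inj_on \<phi> unit_disc"
    and w: "w \<in> unit_disc"
    and eig: "\<And>f. f \<in> hardy2 \<Longrightarrow> L (toeplitz \<phi> f) = \<phi> w * L f"
    and f: "f \<in> hardy2"
  shows "L f = L (disc_restrict (\<lambda>z. 1)) * f w"
proof -
  obtain g where g: "g \<in> hardy2" "\<And>z. z \<in> unit_disc \<Longrightarrow> f z - f w = (\<phi> z - \<phi> w) * g z"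
    by (rule divide_by_univalent_in_hardy2[OF \<phi>(1,3) f w]) blast
  obtain B where B: "B \<ge> 0" "\<And>z. z \<in> unit_disc \<Longrightarrow> cmod (\<phi> z - \<phi> w) \<le> B"
  proof -
    obtain B where "B > 0" "\<And>z. z \<in> unit_disc \<Longrightarrow> cmod (\<phi> z) \<le> B"
      using \<phi>(2) unfolding bounded_pos by auto
    then have "cmod (\<phi> z - \<phi> w) \<le> B + B" if "z \<in> unit_disc" for z
      using that w by (intro norm_triangle_le_diff add_mono) auto
    with \<open>B > 0\<close> that[of "B + B"] show ?thesis by simp
  qed
  have one: "disc_restrict (\<lambda>z. 1) \<in> hardy2"
    by (rule one_in_hardy2)
  have const: "(\<lambda>z. f w * disc_restrict (\<lambda>z. 1) z) \<in> hardy2"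
    using toeplitz_hardy2(1)[of "\<lambda>z. f w" "cmod (f w)", OF _ _ _ one] by (simp add: toeplitz_def)
  have mult: "toeplitz (\<lambda>z. \<phi> z - \<phi> w) g \<in> hardy2"
    by (rule toeplitz_hardy2(1)[OF _ B g(1)]) (intro holomorphic_intros \<phi>(1))
  have "f = (\<lambda>z. toeplitz (\<lambda>z. \<phi> z - \<phi> w) g z + f w * disc_restrict (\<lambda>z. 1) z)"
  proof
    fix z
    show "f z = toeplitz (\<lambda>z. \<phi> z - \<phi> w) g z + f w * disc_restrict (\<lambda>z. 1) z"
      using g(2)[of z] hardy2_outside[OF f, of z] hardy2_outside[OF g(1), of z]
      by (cases "z \<in> unit_disc") (auto simp: toeplitz_def disc_restrict_def algebra_simps)
  qed
  then have "L f = L (toeplitz (\<lambda>z. \<phi> z - \<phi> w) g) + L (\<lambda>z. f w * disc_restrict (\<lambda>z. 1) z)"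
    using bounded_functional_add[OF L mult const] by simp
  moreover have "L (toeplitz (\<lambda>z. \<phi> z - \<phi> w) g) = 0"
    by (rule toeplitz_minus_const_in_kernel[OF L \<phi>(1,2) eig g(1)])
  moreover have "L (\<lambda>z. f w * disc_restrict (\<lambda>z. 1) z) = f w * L (disc_restrict (\<lambda>z. 1))"
    by (rule bounded_functional_scale[OF L one])
  ultimately show ?thesis by simp
qed

lemma eigenfunctional_outside_range:
  assumes L: "bounded_functional_hardy2 L"
    and \<phi>: "\<phi> holomorphic_on unit_disc" "bounded (\<phi> ` unit_disc)" "inj_on \<phi> unit_disc"
    and \<mu>: "\<mu> \<notin> \<phi> ` unit_disc"
    and eig: "\<And>f. f \<in> hardy2 \<Longrightarrow> L (toeplitz \<phi> f) = \<mu> * L f"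
    and f: "f \<in> hardy2"
  shows "L f = 0"
proof (rule univalent_nonvanishing_cyclic[where F = "\<lambda>z. \<phi> z - \<mu>" and L = L and f = f])
  show "(\<lambda>z. \<phi> z - \<mu>) holomorphic_on unit_disc" by (intro holomorphic_intros \<phi>)
  show "bounded ((\<lambda>z. \<phi> z - \<mu>) ` unit_disc)"
    using bounded_translation_minus[OF \<phi>(2), of \<mu>] by (simp add: image_image)
  show "inj_on (\<lambda>z. \<phi> z - \<mu>) unit_disc" using \<phi>(3) by (simp add: inj_on_def)
  show "L (toeplitz (\<lambda>z. \<phi> z - \<mu>) g) = 0" if "g \<in> hardy2" for g
    by (rule toeplitz_minus_const_in_kernel[OF L \<phi>(1,2) eig that])
qed (use \<mu> f L in auto)

section \<open>Intertwining operators\<close>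

text \<open>
  The zeros of \<open>h\<close> are isolated, so Riemann's theorem on removable singularities applies at each of
  them; the bound passes to the limit.
\<close>

lemma extend_over_zeros:
  assumes h: "h holomorphic_on S" "open S" "connected S"
    and w: "w holomorphic_on {z \<in> S. h z \<noteq> 0}"
    and bdd: "\<And>z. z \<in> S \<Longrightarrow> h z \<noteq> 0 \<Longrightarrow> cmod (w z) \<le> B"
    and nz: "\<beta> \<in> S" "h \<beta> \<noteq> 0"
  obtains v where "v holomorphic_on S" "\<And>z. z \<in> S \<Longrightarrow> h z \<noteq> 0 \<Longrightarrow> v z = w z"
    "\<And>z. z \<in> S \<Longrightarrow> cmod (v z) \<le> B"
proof -
  define v where "v = (\<lambda>z. if h z \<noteq> 0 then w z else Lim (at z) w)"
  have loc: "\<exists>g r. r > 0 \<and> ball a r \<subseteq> S \<and> g holomorphic_on ball a r \<and>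
      (\<forall>z\<in>ball a r. g z = v z) \<and> (\<forall>z\<in>ball a r - {a}. h z \<noteq> 0)" if a: "a \<in> S" for a
  proof (cases "h a = 0")
    case False
    have "open {z \<in> S. h z \<noteq> 0}"
      using continuous_open_preimage[OF holomorphic_on_imp_continuous_on[OF h(1)] h(2), of "UNIV - {0}"]
      by (simp add: vimage_def Int_def open_delete)
    then obtain r where r: "r > 0" "ball a r \<subseteq> {z \<in> S. h z \<noteq> 0}"
      using a False open_contains_ball_eq by (metis (mono_tags, lifting) mem_Collect_eq)
    then have "w holomorphic_on ball a r" "\<forall>z\<in>ball a r. w z = v z"
      using holomorphic_on_subset[OF w] by (auto simp: v_def)
    then show ?thesis using r by (intro exI[of _ w] exI[of _ r]) auto
  next
    case True
    obtain r where r: "r > 0" "ball a r \<subseteq> S" "\<And>z. z \<in> ball a r - {a} \<Longrightarrow> h z \<noteq> 0"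
      by (rule isolated_zeros[OF h a True nz]) blast
    have "\<forall>\<^sub>F z in at a. cmod (w z) \<le> B"
      unfolding eventually_at
    proof (intro exI[of _ r] conjI ballI impI)
      fix z assume "z \<noteq> a \<and> dist z a < r"
      then have "z \<in> ball a r - {a}" by (simp add: dist_commute)
      then show "cmod (w z) \<le> B" using r(2,3) by (intro bdd) auto
    qed (rule r(1))
    then obtain g where g: "g holomorphic_on ball a r" "\<And>z. z \<in> ball a r - {a} \<Longrightarrow> g z = w z"
      using holomorphic_on_extend_bounded[of w "ball a r" a] holomorphic_on_subset[OF w, of "ball a r - {a}"] r
      by (auto simp: subset_iff)
    have "g \<midarrow>a\<rightarrow> g a"
      using g(1) r(1) by (metis centre_in_ball continuous_on_eq_continuous_at holomorphic_on_imp_continuous_on isCont_def open_ball)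
    then have "w \<midarrow>a\<rightarrow> g a"
      by (rule Lim_transform_within_open[of _ _ _ _ "ball a r"]) (use r g in auto)
    then have "v a = g a" using True by (simp add: v_def tendsto_Lim)
    moreover have "v z = g z" if "z \<in> ball a r - {a}" for z
      using g(2)[OF that] r(3)[OF that] by (simp add: v_def)
    ultimately have "\<forall>z\<in>ball a r. g z = v z" by (metis DiffI singletonD)
    then show ?thesis using g(1) r by (intro exI[of _ g] exI[of _ r]) auto
  qed
  have v: "v holomorphic_on S"
    unfolding holomorphic_on_open[OF h(2)]
  proof
    fix a assume "a \<in> S"
    then obtain g r where g: "r > 0" "g holomorphic_on ball a r" "\<forall>z\<in>ball a r. g z = v z"
      using loc by blast
    then have "v holomorphic_on ball a r" using holomorphic_transform by metis
    then show "\<exists>f'. (v has_field_derivative f') (at a)"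
      using g(1) holomorphic_on_open[OF open_ball] by (metis centre_in_ball)
  qed
  have v_eq: "v z = w z" if "h z \<noteq> 0" for z using that by (simp add: v_def)
  have "cmod (v a) \<le> B" if a: "a \<in> S" for a
  proof -
    obtain r where r: "r > 0" "ball a r \<subseteq> S" "\<forall>z\<in>ball a r - {a}. h z \<noteq> 0"
      using loc[OF a] by blast
    have "v \<midarrow>a\<rightarrow> v a"
      using v a h(2) by (metis continuous_on_eq_continuous_at holomorphic_on_imp_continuous_on isCont_def)
    then have "((\<lambda>z. cmod (v z)) \<longlongrightarrow> cmod (v a)) (at a)" by (rule tendsto_norm)
    moreover have "\<forall>\<^sub>F z in at a. cmod (v z) \<le> B"
      unfolding eventually_at
    proof (intro exI[of _ r] conjI ballI impI)
      fix z assume "z \<noteq> a \<and> dist z a < r"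
      then have "z \<in> ball a r - {a}" by (simp add: dist_commute)
      then show "cmod (v z) \<le> B" using r bdd v_eq by (metis DiffD1 subsetD)
    qed (use r in auto)
    ultimately show ?thesis by (rule tendsto_upperbound) simp
  qed
  then show ?thesis using that v v_eq by blast
qed

theorem corollary4p3:
  fixes \<phi> \<psi> :: "complex \<Rightarrow> complex"
    and X :: "(complex \<Rightarrow> complex) \<Rightarrow> (complex \<Rightarrow> complex)"
  assumes "\<phi> holomorphic_on unit_disc" and "bounded (\<phi> ` unit_disc)"
    and "\<psi> holomorphic_on unit_disc" and "bounded (\<psi> ` unit_disc)"
    and "inj_on \<phi> unit_disc"
    and "bounded_operator_hardy2 X"
    and "\<exists>f\<in>hardy2. X f \<noteq> (\<lambda>z. 0)"
    and "\<forall>f\<in>hardy2. X (toeplitz \<phi> f) = toeplitz \<psi> (X f)"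
  shows "is_weighted_composition_operator X"
proof -
  note \<phi> = assms(1,2,5)
  define h where "h = X (disc_restrict (\<lambda>z. 1))"
  have X_H: "X f \<in> hardy2" if "f \<in> hardy2" for f
    using assms(6) that unfolding bounded_operator_hardy2_def by blast
  have h_H: "h \<in> hardy2"
    unfolding h_def by (intro X_H one_in_hardy2)
  obtain f0 where f0: "f0 \<in> hardy2" "X f0 \<noteq> (\<lambda>z. 0)" using assms(7) by blast
  obtain \<beta> where \<beta>: "X f0 \<beta> \<noteq> 0" using f0(2) by auto
  then have \<beta>_disc: "\<beta> \<in> unit_disc" using hardy2_outside[OF X_H[OF f0(1)]] by blast
  have eig: "X (toeplitz \<phi> f) z = \<psi> z * X f z" if "f \<in> hardy2" for f z
    using assms(8) that by (simp add: toeplitz_def)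
  \<comment> \<open>The operator is first computed at the points where \<open>X f0\<close> does not vanish.\<close>
  define W where "W = {z \<in> unit_disc. X f0 z \<noteq> 0}"
  have W_sub: "W \<subseteq> unit_disc" by (auto simp: W_def)
  have W_open: "open W"
    using continuous_open_preimage[OF holomorphic_on_imp_continuous_on[OF hardy2_holomorphic[OF X_H[OF f0(1)]]]
        open_ball, of "UNIV - {0}"]
    by (simp add: W_def vimage_def Int_def open_delete)
  have \<psi>_range: "\<psi> z \<in> \<phi> ` unit_disc" if "z \<in> W" for z
  proof (rule ccontr)
    assume "\<psi> z \<notin> \<phi> ` unit_disc"
    moreover have "z \<in> unit_disc" using that W_sub by blast
    ultimately have "X f0 z = 0"
      by (intro eigenfunctional_outside_range[where L = "\<lambda>f. X f z", OF _ \<phi> _ eig f0(1)]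
          bounded_functional_evaluation[OF assms(6)])
    with that show False by (simp add: W_def)
  qed
  obtain \<kappa> where \<kappa>: "\<kappa> holomorphic_on \<phi> ` unit_disc" "\<And>z. z \<in> unit_disc \<Longrightarrow> \<kappa> (\<phi> z) = z"
    by (rule holomorphic_has_inverse[OF \<phi>(1) open_ball \<phi>(3)]) (rule that)
  have \<kappa>\<psi>: "\<kappa> (\<psi> z) \<in> unit_disc" "\<phi> (\<kappa> (\<psi> z)) = \<psi> z" if "z \<in> W" for z
    using \<psi>_range[OF that] \<kappa>(2) by auto
  have \<kappa>\<psi>_holo: "(\<lambda>z. \<kappa> (\<psi> z)) holomorphic_on W"
    using holomorphic_on_compose_gen[OF holomorphic_on_subset[OF assms(3) W_sub] \<kappa>(1)] \<psi>_range
    by (auto simp: o_def)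
  have formula: "X f z = h z * f (\<kappa> (\<psi> z))" if "z \<in> W" "f \<in> hardy2" for f z
  proof -
    have "X f z = X (disc_restrict (\<lambda>z. 1)) z * f (\<kappa> (\<psi> z))"
    proof (rule eigenfunctional_in_range[OF bounded_functional_evaluation[OF assms(6)] \<phi> _ _ that(2)])
      show "X (toeplitz \<phi> g) z = \<phi> (\<kappa> (\<psi> z)) * X g z" if "g \<in> hardy2" for g
        using eig[OF that] \<kappa>\<psi>(2)[OF \<open>z \<in> W\<close>] by simp
    qed (use that W_sub \<kappa>\<psi> in auto)
    then show ?thesis by (simp add: h_def)
  qed
  obtain \<omega> where \<omega>: "\<omega> holomorphic_on unit_disc" "\<And>z. z \<in> W \<Longrightarrow> \<omega> z = \<kappa> (\<psi> z)"
    "\<And>z. z \<in> unit_disc \<Longrightarrow> cmod (\<omega> z) \<le> 1"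
  proof (rule extend_over_zeros[of "X f0" unit_disc "\<lambda>z. \<kappa> (\<psi> z)" 1 \<beta>])
    show "cmod (\<kappa> (\<psi> z)) \<le> 1" if "z \<in> unit_disc" "X f0 z \<noteq> 0" for z
      using \<kappa>\<psi>(1)[of z] that by (simp add: W_def)
  qed (use \<kappa>\<psi>_holo \<beta> \<beta>_disc hardy2_holomorphic[OF X_H[OF f0(1)]] in \<open>auto simp: W_def\<close>)
  have \<beta>W: "\<beta> \<in> W" using \<beta> \<beta>_disc by (simp add: W_def)
  have \<omega>_disc: "\<omega> z \<in> unit_disc" if z: "z \<in> unit_disc" for z
  proof (rule ccontr)
    assume "\<omega> z \<notin> unit_disc"
    then have "cmod (\<omega> u) \<le> cmod (\<omega> z)" if "u \<in> unit_disc" for u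
      using \<omega>(3)[OF that] by simp
    then have "\<omega> constant_on unit_disc"
      by (intro maximum_modulus_principle[OF \<omega>(1) _ _ open_ball order_refl z]) auto
    then have "\<omega> z = \<omega> \<beta>" using z \<beta>_disc unfolding constant_on_def by metis
    then show False using \<open>\<omega> z \<notin> unit_disc\<close> \<kappa>\<psi>(1)[OF \<beta>W] \<omega>(2)[OF \<beta>W] by simp
  qed
  have X_eq: "X f = weighted_comp \<omega> h f" if f: "f \<in> hardy2" for f
  proof
    fix z
    show "X f z = weighted_comp \<omega> h f z"
    proof (cases "z \<in> unit_disc")
      case True
      have "(\<lambda>z. f (\<omega> z)) holomorphic_on unit_disc"
        using holomorphic_on_compose_gen[OF \<omega>(1) hardy2_holomorphic[OF f] image_subsetI[OF \<omega>_disc]]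
        by (simp add: o_def)
      then have hf: "(\<lambda>z. h z * f (\<omega> z)) holomorphic_on unit_disc"
        by (rule holomorphic_on_mult[OF hardy2_holomorphic[OF h_H]])
      have "X f z = h z * f (\<omega> z)"
        by (rule analytic_continuation_open[OF W_open open_ball _ _ W_sub hardy2_holomorphic[OF X_H[OF f]] hf])
          (use \<beta>W \<omega>(2) formula[OF _ f] True in auto)
      then show ?thesis by (simp add: weighted_comp_def)
    next
      case False
      then show ?thesis
        using hardy2_outside[OF X_H[OF f]] hardy2_outside[OF h_H] by (simp add: weighted_comp_def)
    qed
  qed
  have "weighted_comp \<omega> h f \<in> hardy2" if "f \<in> hardy2" for f
    using X_H[OF that] X_eq[OF that] by simp
  then show ?thesis
    unfolding is_weighted_composition_operator_def using \<omega>(1) \<omega>_disc h_H X_eq by blast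
qed

end
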